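(* Let $B=(\beta_{p-1},\ldots,\beta_0)$ be a Parry alternate base. The infinite sequence $v_B$ is sturmian if and only if one of the following cases is satisfied. \begin{itemize} \item[Case 1.] We have $p=1$ and $d_B^*(1)=(d0)^\omega$ with $d\ge1$, in which case $\beta_0$ is the positive root of $X^2-dX-1$ and $v_B$ is the sturmian sequence fixed by the substitution $0\mapsto 0^d1,\ 1\mapsto 0$. \item[Case 2.] We have $p=1$ and $d_B^*(1)=(d+1)d^\omega$ for $d\ge1$, in which case $\beta_0$ is the largest root of $X^2-(d+2)X+1$ and $v_B$ is the sturmian sequence fixed by the substitution $0\mapsto 0^{d+1}1,\ 1\mapsto 0^d1$. \item[Case 3.] We have $p=2$ and $d_B^*(1)=(d0)^\omega$, $d_{S(B)}^*(1)=(e0)^\omega$ with $d,e\ge1$, in which case $\beta_0$ and $\beta_1$ are the largest roots of $dX^2-deX-e$ and $eX^2-deX-d$ respectively, the product $\beta_1\beta_0$ is the largest root of $X^2-(de+2)X+1$, and $v_B$ is the sturmian sequence fixed by the substitution $0\mapsto(0^e1)^d0,\ 1\mapsto 0^e1$. \end{itemize} Here $d,e$ denote integers.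
   Context: $\mathbb N=\{0,1,2,\dots\}$. An alternate base of period $p\ge1$ is a bi-infinite periodic sequence $B=(\beta_n)_{n\in\mathbb Z}$ of real numbers greater than $1$ with $\beta_{n+p}=\beta_n$ for all $n$; it is denoted $B=(\beta_{p-1},\ldots,\beta_0)$. For $N\in\mathbb Z$, $S^N(B)=(\beta_{n+N})_{n\in\mathbb Z}$, $S=S^1$. For a finite word $u$, $u^\omega=uuu\cdots$. $B$-expansion $d_B(x)=(a_n)_{n\in\mathbb Z}$, written $\cdots a_1a_0\bullet a_{-1}a_{-2}\cdots$, of a real $x\ge0$. If $x\in[0,1)$: $a_n=0$ for $n\ge 0$, $r_{-1}=x$, and for $n\le -1$ iteratively $a_n=\lfloor\beta_n r_n\rfloor$, $r_{n-1}=\beta_n r_n-a_n$. If $x\ge 1$: let $N\ge0$ be minimal with $x<\beta_N\cdots\beta_0$, put $a_n=0$ for $n>N$, $r_N=x/(\beta_N\cdots\beta_0)$, and for $n\le N$ iteratively $a_n=\lfloor\beta_n r_n\rfloor$, $r_{n-1}=\beta_n r_n-a_n$. A $B$-integer is a real $x\ge0$ whose $B$-expansion has only zeros after the radix point ($a_n=0$ for all $n<0$). The set of $B$-integers is unbounded without accumulation points; $(x_k)_{k\in\mathbb N}$ is its increasing enumeration. The sequence $w_B=(w_k)_{k\in\mathbb N}$ over $\mathbb N$ is defined by: $w_k$ is the greatest $n\in\mathbb N$ such that $d_B(x_k)$ and $d_B(x_{k+1})$ differ at index $n$. Quasi-greedy expansion of $1$: the limit $\lim_{x\to1^-}d_B(x)$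 (in the product topology) exists and has the form $0\bullet a_{-1}a_{-2}\cdots$; one sets $d_B^*(1)=a_{-1}a_{-2}\cdots$. $B$ is Parry if $d^*_{S^i(B)}(1)$ is eventually periodic for every $i\in\{0,\ldots,p-1\}$. For a Parry alternate base $B$, let $\ell\ge0$ and $m\ge1$ be such that $d^*_{S^i(B)}(1)$ has preperiod $\ell p$ and period $mp$ for every $i\in\{0,\dots,p-1\}$. The infinite word $v_B=(v_k)_{k\in\mathbb N}$ over the alphabet $\{0,\ldots,\ell p+mp-1\}$ is given by $v_k=w_k$ if $0\le w_k<\ell p$, and $v_k=\ell p+((w_k-\ell p)\bmod mp)$ otherwise. A sequence $(v_n)_{n\in\mathbb N}$ over a two-letter alphabet $\{a,b\}$ is balanced if for all $n,i,j\in\mathbb N$ the numbers of occurrences of $a$ in $v_i\cdots v_{i+n-1}$ and $v_j\cdots v_{j+n-1}$ differ by at most $1$. A sturmian sequence is a balanced sequence over a two-letter alphabet that is not eventually periodic. A sequence is fixed by a substitution if applying the substitution letter by letter (concatenating images) gives back the same sequence. *)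

theory Defs
  imports
    "HOL-Analysis.Analysis"
    "HOL-Computational_Algebra.Polynomial"
    "HOL-Library.Omega_Words_Fun"
begin

section \<open>Words\<close>

text \<open>Here \<open>n\<close> is a preperiod and \<open>q\<close> a period; neither is required to be the shortest one.\<close>

definition periodic_from :: "'a word \<Rightarrow> nat \<Rightarrow> nat \<Rightarrow> bool" where
  "periodic_from w n q \<longleftrightarrow> q \<ge> 1 \<and> (\<forall>k\<ge>n. w (k + q) = w k)"

definition eventually_periodic :: "'a word \<Rightarrow> bool" where
  "eventually_periodic w \<longleftrightarrow> (\<exists>n q. periodic_from w n q)"

definition balanced_over :: "'a \<Rightarrow> 'a \<Rightarrow> 'a word \<Rightarrow> bool" where
  "balanced_over a b w \<longleftrightarrow> a \<noteq> b \<and> range w \<subseteq> {a, b} \<and>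
     (\<forall>n i j. \<bar>int (count_list (w [i \<rightarrow> i + n]) a) - int (count_list (w [j \<rightarrow> j + n]) a)\<bar> \<le> 1)"

definition sturmian_over :: "'a \<Rightarrow> 'a \<Rightarrow> 'a word \<Rightarrow> bool" where
  "sturmian_over a b w \<longleftrightarrow> balanced_over a b w \<and> \<not> eventually_periodic w"

definition sturmian :: "'a word \<Rightarrow> bool" where
  "sturmian w \<longleftrightarrow> (\<exists>a b. sturmian_over a b w)"

definition subst_list :: "('a \<Rightarrow> 'b list) \<Rightarrow> 'a list \<Rightarrow> 'b list" where
  "subst_list \<sigma> u = concat (map \<sigma> u)"

text \<open>
  The images of the finite prefixes of \<open>w\<close> are prefixes of \<open>w\<close>; the second condition says that the
  concatenation of all the images is an infinite word, so that it is all of \<open>w\<close>.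
\<close>

definition fixed_by_subst :: "('a \<Rightarrow> 'a list) \<Rightarrow> 'a word \<Rightarrow> bool" where
  "fixed_by_subst \<sigma> w \<longleftrightarrow>
     (\<forall>n. subst_list \<sigma> (prefix n w) = prefix (length (subst_list \<sigma> (prefix n w))) w) \<and>
     (\<forall>k. \<exists>n. length (subst_list \<sigma> (prefix n w)) \<ge> k)"

text \<open>
  The substitution \<open>0 \<mapsto> u, 1 \<mapsto> v\<close>. It is only applied to words over \<open>{0, 1}\<close>, so its value at
  other letters is irrelevant.
\<close>

definition subst01 :: "nat list \<Rightarrow> nat list \<Rightarrow> nat \<Rightarrow> nat list" where
  "subst01 u v a = (if a = 0 then u else v)"

definition list_power :: "'a list \<Rightarrow> int \<Rightarrow> 'a list" where
  "list_power u n = concat (replicate (nat n) u)"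

definition is_the_sturmian_fixed_by :: "nat word \<Rightarrow> (nat \<Rightarrow> nat list) \<Rightarrow> bool" where
  "is_the_sturmian_fixed_by w \<sigma> \<longleftrightarrow> {u. sturmian_over 0 1 u \<and> fixed_by_subst \<sigma> u} = {w}"

section \<open>Roots of real polynomials\<close>

definition is_the_positive_root :: "real poly \<Rightarrow> real \<Rightarrow> bool" where
  "is_the_positive_root f x \<longleftrightarrow> {y. y > 0 \<and> poly f y = 0} = {x}"

definition is_largest_root :: "real poly \<Rightarrow> real \<Rightarrow> bool" where
  "is_largest_root f x \<longleftrightarrow> poly f x = 0 \<and> (\<forall>y. poly f y = 0 \<longrightarrow> y \<le> x)"

section \<open>Alternate bases and their expansions\<close>

text \<open>\<open>p\<close> is a period of \<open>\<beta>\<close>, not necessarily the least one.\<close>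

definition alternate_base :: "nat \<Rightarrow> (int \<Rightarrow> real) \<Rightarrow> bool" where
  "alternate_base p \<beta> \<longleftrightarrow> p \<ge> 1 \<and> (\<forall>n. \<beta> n > 1) \<and> (\<forall>n. \<beta> (n + int p) = \<beta> n)"

definition shift_base :: "int \<Rightarrow> (int \<Rightarrow> real) \<Rightarrow> int \<Rightarrow> real" where
  "shift_base N \<beta> = (\<lambda>n. \<beta> (n + N))"

text \<open>
  The index at which the greedy algorithm starts: \<open>-1\<close> on \<open>[0,1)\<close>, otherwise the minimal \<open>N \<ge> 0\<close>
  with \<open>x < \<beta>\<^sub>N \<cdots> \<beta>\<^sub>0\<close>.
\<close>

definition top_index :: "(int \<Rightarrow> real) \<Rightarrow> real \<Rightarrow> int" where
  "top_index \<beta> x = (if x < 1 then -1 else int (LEAST N::nat. x < (\<Prod>i\<in>{0..int N}. \<beta> i)))"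

text \<open>\<open>remainder \<beta> N r k\<close> is \<open>r\<^bsub>N-k\<^esub>\<close> when the algorithm starts with \<open>r\<^sub>N = r\<close>.\<close>

fun remainder :: "(int \<Rightarrow> real) \<Rightarrow> int \<Rightarrow> real \<Rightarrow> nat \<Rightarrow> real" where
  "remainder \<beta> N r 0 = r"
| "remainder \<beta> N r (Suc k) =
     \<beta> (N - int k) * remainder \<beta> N r k - of_int \<lfloor>\<beta> (N - int k) * remainder \<beta> N r k\<rfloor>"

text \<open>For \<open>0 \<le> x < 1\<close> the product below is empty, and the algorithm starts with \<open>r\<^bsub>-1\<^esub> = x\<close>.\<close>

definition expansion :: "(int \<Rightarrow> real) \<Rightarrow> real \<Rightarrow> int \<Rightarrow> int" where
  "expansion \<beta> x n =
     (let N = top_index \<beta> x; r = x / (\<Prod>i\<in>{0..N}. \<beta> i)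
      in if n > N then 0 else \<lfloor>\<beta> n * remainder \<beta> N r (nat (N - n))\<rfloor>)"

definition B_integers :: "(int \<Rightarrow> real) \<Rightarrow> real set" where
  "B_integers \<beta> = {x. x \<ge> 0 \<and> (\<forall>n<0. expansion \<beta> x n = 0)}"

definition B_integer_enum :: "(int \<Rightarrow> real) \<Rightarrow> nat \<Rightarrow> real" where
  "B_integer_enum \<beta> = (THE x. strict_mono x \<and> range x = B_integers \<beta>)"

definition w_word :: "(int \<Rightarrow> real) \<Rightarrow> nat word" where
  "w_word \<beta> k = (GREATEST n::nat. expansion \<beta> (B_integer_enum \<beta> k) (int n)
                                \<noteq> expansion \<beta> (B_integer_enum \<beta> (Suc k)) (int n))"

text \<open>
  The limit is taken in \<open>int \<Rightarrow> int\<close> with the product topology. (The library has no \<open>t2_space\<close>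
  instance for this type, so \<open>Lim\<close> is written out.)
\<close>

definition left_limit_expansion :: "(int \<Rightarrow> real) \<Rightarrow> int \<Rightarrow> int" where
  "left_limit_expansion \<beta> = (THE a :: int \<Rightarrow> int. (expansion \<beta> \<longlongrightarrow> a) (at_left 1))"

text \<open>The letter at position \<open>k\<close> is the digit at index \<open>-1-k\<close>.\<close>

definition quasi_greedy :: "(int \<Rightarrow> real) \<Rightarrow> int word" where
  "quasi_greedy \<beta> k = left_limit_expansion \<beta> (- 1 - int k)"

definition parry :: "nat \<Rightarrow> (int \<Rightarrow> real) \<Rightarrow> bool" where
  "parry p \<beta> \<longleftrightarrow> (\<forall>i<p. eventually_periodic (quasi_greedy (shift_base (int i) \<beta>)))"

text \<open>
  The least \<open>\<ell> \<ge> 0\<close> and \<open>m \<ge> 1\<close> such that \<open>\<ell> p\<close> is a preperiod and \<open>m p\<close> a period of all the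
  quasi-greedy expansions. The two minimisations are independent: a preperiod of a word is a
  preperiod for each of its eventual periods.
\<close>

definition common_periodic :: "nat \<Rightarrow> (int \<Rightarrow> real) \<Rightarrow> nat \<Rightarrow> nat \<Rightarrow> bool" where
  "common_periodic p \<beta> l m \<longleftrightarrow>
     m \<ge> 1 \<and> (\<forall>i<p. periodic_from (quasi_greedy (shift_base (int i) \<beta>)) (l * p) (m * p))"

definition preperiod_par :: "nat \<Rightarrow> (int \<Rightarrow> real) \<Rightarrow> nat" where
  "preperiod_par p \<beta> = (LEAST l. \<exists>m. common_periodic p \<beta> l m)"

definition period_par :: "nat \<Rightarrow> (int \<Rightarrow> real) \<Rightarrow> nat" where
  "period_par p \<beta> = (LEAST m. \<exists>l. common_periodic p \<beta> l m)"

definition v_word :: "nat \<Rightarrow> (int \<Rightarrow> real) \<Rightarrow> nat word" where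
  "v_word p \<beta> k =
     (let l = preperiod_par p \<beta>; m = period_par p \<beta>; w = w_word \<beta> k
      in if w < l * p then w else l * p + (w - l * p) mod (m * p))"

end

theory Submission
  imports Defs
begin

text \<open>
  Let \<open>P\<^sub>N = \<beta>\<^bsub>N-1\<^esub> \<cdots> \<beta>\<^sub>0\<close>, let \<open>c\<^sub>N\<close> be the number of \<open>B\<close>-integers below \<open>P\<^sub>N\<close>, and let \<open>V\<^sub>N\<close> be the prefix
  of length \<open>c\<^sub>N\<close> of \<open>v\<^sub>B\<close>. Above a multiple of \<open>P\<^sub>N\<close> the integers repeat those below \<open>P\<^sub>N\<close> until
  \<open>P\<^bsub>N+1\<^esub>\<close> is reached. Cutting \<open>[0, P\<^sub>N)\<close> into copies of \<open>[0, P\<^bsub>N-1\<^esub>)\<close>, the rest into copies of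
  \<open>[0, P\<^bsub>N-2\<^esub>)\<close>, and so on, is the quasi-greedy algorithm. Hence \<open>V\<^sub>N\<close> is \<open>V\<^bsub>N-1\<^esub>\<close> to the power \<open>t\<^sub>1\<close>,
  \<open>V\<^bsub>N-2\<^esub>\<close> to the power \<open>t\<^sub>2\<close>, and so on, followed by the letter of the index \<open>N\<close>, where \<open>t\<^sub>1 t\<^sub>2 \<cdots>\<close>
  is the quasi-greedy expansion of 1 that starts with the base \<open>\<beta>\<^bsub>N-1\<^esub>\<close> (lemma \<open>v_block_decomp\<close>).

  The letter of the index \<open>N\<close> ends \<open>V\<^sub>N\<close>, so all \<open>\<ell> p + m p\<close> letters occur in \<open>v\<^sub>B\<close>, and a sturmian \<open>v\<^sub>B\<close>
  needs \<open>\<ell> p + m p = 2\<close>. Two types remain. For \<open>\<ell> = 0\<close> the expansions have period 2, and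
  periodicity turns the decomposition into \<open>V\<^bsub>N+2\<^esub> = V\<^bsub>N+1\<^esub>\<^sup>s V\<^sub>N\<^sup>t V\<^sub>N\<close> with the two digits \<open>s\<close> and \<open>t\<close> of
  that level; a digit \<open>t \<noteq> 0\<close> creates unbalanced factors (\<open>second_digit_zero_if_balanced\<close>). For
  \<open>p = \<ell> = m = 1\<close> the expansion is \<open>a b\<^sup>\<omega>\<close>, and \<open>a > b + 1\<close> creates unbalanced factors
  (\<open>first_digit_le_if_balanced\<close>).

  In the remaining cases the recursion of the \<open>V\<^sub>N\<close> shows that the substitution maps blocks to blocks, so
  that \<open>v\<^sub>B\<close> is fixed by it. A fixed word is sturmian because it codes a rotation: with \<open>\<alpha>\<close>
  the frequency of the letter 1, the discrepancy \<open>\<alpha> n - |u|\<^sub>1\<close> of a prefix \<open>u\<close> of length \<open>n\<close> is contracted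
  by the substitution, and an induction along it shows that it stays in an interval of length 1
  (\<open>fixed_word_codes\<close>, \<open>sturmian_over_if_bounded_disc\<close>); and \<open>\<alpha>\<close> is irrational, as otherwise the
  module \<open>\<int>\<alpha> + \<int>(\<alpha> - 1)\<close>, which the contraction maps into itself, would be discrete. The bases are found
  from the periodicity of the quasi-greedy remainders (\<open>qg_remainder_eq_if_digits_eq\<close>).
\<close>

section \<open>Powers, substitutions and fixed words\<close>

lemma list_power_0 [simp]: "list_power u 0 = []"
  by (simp add: list_power_def)

lemma list_power_1 [simp]: "list_power u 1 = u"
  by (simp add: list_power_def)

lemma list_power_add:
  assumes "m \<ge> 0" "n \<ge> 0"
  shows "list_power u (m + n) = list_power u m @ list_power u n"
  using assms by (simp add: list_power_def nat_add_distrib replicate_add)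

lemma list_power_plus_1: "n \<ge> 0 \<Longrightarrow> list_power u (n + 1) = list_power u n @ u"
  by (simp add: list_power_add)

lemma list_power_1_plus: "n \<ge> 0 \<Longrightarrow> list_power u (n + 1) = u @ list_power u n"
  using list_power_add[of 1 n u] by (simp add: add.commute)

lemma list_power_letter: "list_power [a] n = replicate (nat n) a"
  by (simp add: list_power_def)

lemma map_list_power: "map f (list_power u n) = list_power (map f u) n"
  by (simp add: list_power_def map_concat)

lemma subst_list_Nil [simp]: "subst_list \<sigma> [] = []"
  by (simp add: subst_list_def)

lemma subst_list_Cons [simp]: "subst_list \<sigma> (a # u) = \<sigma> a @ subst_list \<sigma> u"
  by (simp add: subst_list_def)

lemma subst_list_append [simp]: "subst_list \<sigma> (u @ v) = subst_list \<sigma> u @ subst_list \<sigma> v"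
  by (simp add: subst_list_def)

lemma subst_list_power: "subst_list \<sigma> (list_power u n) = list_power (subst_list \<sigma> u) n"
proof -
  have "subst_list \<sigma> (concat (replicate k u)) = concat (replicate k (subst_list \<sigma> u))" for k
    by (induction k) simp_all
  then show ?thesis by (simp add: list_power_def)
qed

lemma subst01_0 [simp]: "subst01 u v 0 = u"
  and subst01_1 [simp]: "subst01 u v (Suc 0) = v"
  by (simp_all add: subst01_def)

lemma length_subst_list_ge:
  assumes "\<And>a. \<sigma> a \<noteq> []"
  shows "length (subst_list \<sigma> u) \<ge> length u"
proof (induction u)
  case (Cons a u)
  have "length (\<sigma> a) \<ge> 1" using assms by (simp add: Suc_leI)
  then show ?case using Cons by simp
qed simp

lemma prefix_eq_take: "m \<le> n \<Longrightarrow> prefix m w = take m (prefix n w)"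
  by (simp add: min_def)

lemma prefix_eqD: "prefix n u = prefix n v \<Longrightarrow> m \<le> n \<Longrightarrow> prefix m u = prefix m v"
  by (metis prefix_eq_take)

lemma prefix_if_mod:
  assumes mod: "\<And>k. k < n \<Longrightarrow> x k = x (k mod c)" and n: "n = t * c + r" and r: "r \<le> c"
  shows "prefix n x = concat (replicate t (prefix c x)) @ prefix r x"
proof -
  have block: "x [i * c \<rightarrow> i * c + c'] = prefix c' x" if "i * c + c' \<le> n" "c' \<le> c" for i c'
  proof (rule nth_equalityI)
    fix k assume "k < length (x [i * c \<rightarrow> i * c + c'])"
    then have k: "k < c'" by simp
    then have "(i * c + k) mod c = k" using that(2) by simp
    then show "x [i * c \<rightarrow> i * c + c'] ! k = prefix c' x ! k"
      using mod[of "i * c + k"] that(1) k by simp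
  qed simp
  have powers: "prefix (i * c) x = concat (replicate i (prefix c x))" if "i \<le> t" for i
    using that
  proof (induction i)
    case (Suc i)
    have "Suc i * c \<le> t * c" using Suc.prems by (rule mult_le_mono1)
    then have le: "i * c + c \<le> n" using n by simp
    have "prefix (Suc i * c) x = prefix (i * c) x @ prefix c x"
      using subsequence_append[of x "i * c" c] block[OF le] by (simp add: add.commute)
    also have "\<dots> = concat (replicate (Suc i) (prefix c x))"
      using Suc replicate_append_same[of i "prefix c x"]
      by (metis Suc_leD append.right_neutral concat.simps concat_append replicate_Suc)
    finally show ?case .
  qed simp
  show ?thesis
    unfolding n subsequence_append using powers[of t] block[of t r] n r by simp
qed

lemma fixed_by_substD:
  assumes "fixed_by_subst \<sigma> w"
  shows "prefix (length (subst_list \<sigma> (prefix n w))) w = subst_list \<sigma> (prefix n w)"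
  by (rule sym) (use assms in \<open>unfold fixed_by_subst_def, blast\<close>)

text \<open>
  If \<open>\<sigma>\<close> maps each of the prefixes \<open>V\<^sub>N\<close> of \<open>v\<close> to another one, then \<open>v\<close> is fixed by \<open>\<sigma>\<close>, as every
  prefix of \<open>v\<close> is a prefix of some \<open>V\<^sub>N\<close>.
\<close>

lemma fixed_by_subst_if_prefixes:
  assumes ne: "\<And>a. \<sigma> a \<noteq> []"
    and pre: "\<And>N. prefix (length (V N)) v = V N"
    and unbounded: "\<And>k. \<exists>N. length (V N) \<ge> k"
    and step: "\<And>N. subst_list \<sigma> (V N) = V (N + s)"
  shows "fixed_by_subst \<sigma> v"
  unfolding fixed_by_subst_def
proof (intro conjI allI)
  fix n
  obtain N where N: "length (V N) \<ge> n" using unbounded by blast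
  have "V N = prefix n v @ drop n (V N)"
    using prefix_eq_take[OF N, of v] unfolding pre by (metis append_take_drop_id)
  then have eq: "V (N + s) = subst_list \<sigma> (prefix n v) @ subst_list \<sigma> (drop n (V N))"
    using step[of N] by (metis subst_list_append)
  have "prefix (length (subst_list \<sigma> (prefix n v))) v
      = take (length (subst_list \<sigma> (prefix n v))) (prefix (length (V (N + s))) v)"
    by (rule prefix_eq_take) (simp add: eq)
  also have "\<dots> = subst_list \<sigma> (prefix n v)"
    unfolding pre by (simp add: eq)
  finally have "prefix (length (subst_list \<sigma> (prefix n v))) v = subst_list \<sigma> (prefix n v)" .
  then show "subst_list \<sigma> (prefix n v) = prefix (length (subst_list \<sigma> (prefix n v))) v" ..
next
  fix k
  show "\<exists>n. length (subst_list \<sigma> (prefix n v)) \<ge> k"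
    using length_subst_list_ge[of \<sigma> "prefix k v", OF ne] by auto
qed

lemma fixed_by_subst_first:
  assumes "fixed_by_subst \<sigma> u" "\<sigma> (u 0) \<noteq> []"
  shows "u 0 = hd (\<sigma> (u 0))"
proof -
  have "prefix (length (\<sigma> (u 0))) u = \<sigma> (u 0)"
    using fixed_by_substD[OF assms(1), of 1] by simp
  then have "prefix (length (\<sigma> (u 0))) u ! 0 = \<sigma> (u 0) ! 0" by simp
  then show ?thesis using assms(2) by (simp add: hd_conv_nth)
qed

lemma fixed_by_subst_unique:
  assumes ne: "\<And>a. \<sigma> a \<noteq> []" and long: "length (\<sigma> 0) \<ge> 2"
    and u: "fixed_by_subst \<sigma> u" "u 0 = (0::nat)" and v: "fixed_by_subst \<sigma> v" "v 0 = 0"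
  shows "u = v"
proof -
  have "prefix (Suc n) u = prefix (Suc n) v" for n
  proof (induction n)
    case 0
    then show ?case using u(2) v(2) by simp
  next
    case (Suc n)
    let ?s = "subst_list \<sigma> (prefix (Suc n) u)"
    have "prefix (Suc n) u = 0 # map u [1..<Suc n]"
      using u(2) by (simp add: subsequence_def upt_conv_Cons del: upt_Suc)
    then have "length ?s = length (\<sigma> 0) + length (subst_list \<sigma> (map u [1..<Suc n]))"
      by simp
    then have len: "length ?s \<ge> Suc (Suc n)"
      using long length_subst_list_ge[of \<sigma> "map u [1..<Suc n]", OF ne] by (simp del: upt_Suc)
    have "prefix (length ?s) v = prefix (length ?s) u"
      using fixed_by_substD[OF v(1), of "Suc n"] fixed_by_substD[OF u(1), of "Suc n"]
      unfolding Suc by (rule trans[OF _ sym])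
    then show ?case using len by (rule prefix_eqD[OF sym])
  qed
  then have "prefix (Suc n) u ! n = prefix (Suc n) v ! n" for n by simp
  then show ?thesis by (simp add: fun_eq_iff del: subseq_to_Suc)
qed

lemma is_the_sturmian_fixed_byI:
  assumes "s \<noteq> []" "t \<noteq> []" "hd s = 0" "hd t = 0" "length s \<ge> 2"
    and "sturmian_over 0 1 v" "fixed_by_subst (subst01 s t) v"
  shows "is_the_sturmian_fixed_by v (subst01 s t)"
proof -
  have first: "u 0 = 0" if "fixed_by_subst (subst01 s t) u" for u
    using fixed_by_subst_first[OF that] assms(1-4)
    by (cases "u 0 = 0") (simp_all add: subst01_def)
  have "u = v" if "fixed_by_subst (subst01 s t) u" for u
    by (rule fixed_by_subst_unique[OF _ _ that first[OF that] assms(7) first[OF assms(7)]])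
      (use assms in \<open>auto simp: subst01_def\<close>)
  then show ?thesis
    using assms(6,7) unfolding is_the_sturmian_fixed_by_def by blast
qed

section \<open>Balanced words\<close>

text \<open>
  A preperiod does not depend on the eventual period that it is taken with.
\<close>

lemma periodic_from_change_preperiod:
  assumes "periodic_from w n q" "periodic_from w n' q'"
  shows "periodic_from w n q'"
proof -
  have shift: "w (k + j * q) = w k" if "k \<ge> n" for k j
  proof (induction j)
    case (Suc j)
    then show ?case
      using assms(1) that unfolding periodic_from_def
      by (metis add.assoc add.commute mult_Suc trans_le_add1)
  qed simp
  have "w (k + q') = w k" if k: "k \<ge> n" for k
  proof -
    have "q \<ge> 1" using assms(1) by (simp add: periodic_from_def)
    then have n': "k + n' * q \<ge> n'" by (cases q) auto
    have "w (k + q') = w (k + q' + n' * q)" using shift[of "k + q'" n'] k by simp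
    also have "\<dots> = w (k + n' * q + q')" by (simp add: ac_simps)
    also have "\<dots> = w (k + n' * q)" using assms(2) n' by (simp add: periodic_from_def)
    also have "\<dots> = w k" using shift[OF k] by simp
    finally show ?thesis .
  qed
  then show ?thesis using assms(2) by (simp add: periodic_from_def)
qed

lemma count_list_two_letters:
  assumes "set u \<subseteq> {a, b}" "a \<noteq> b"
  shows "count_list u a + count_list u b = length u"
  using assms by (induction u) auto

lemma balanced_over_swap:
  assumes "balanced_over a b w"
  shows "balanced_over b a w"
proof -
  have "int (count_list (w [i \<rightarrow> i + n]) b) = int n - int (count_list (w [i \<rightarrow> i + n]) a)" for i n
  proof -
    have "a \<noteq> b" "set (w [i \<rightarrow> i + n]) \<subseteq> {a, b}"
      using assms by (auto simp: balanced_over_def)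
    then have "count_list (w [i \<rightarrow> i + n]) a + count_list (w [i \<rightarrow> i + n]) b = n"
      using count_list_two_letters[of "w [i \<rightarrow> i + n]" a b] by simp
    then show ?thesis by linarith
  qed
  then show ?thesis
    using assms unfolding balanced_over_def by (auto simp: abs_le_iff)
qed

lemma sturmian_overI:
  assumes "sturmian w" "a \<noteq> b" "a \<in> range w" "b \<in> range w"
  shows "sturmian_over a b w"
proof -
  obtain a' b' where w: "sturmian_over a' b' w" using assms(1) by (auto simp: sturmian_def)
  then have "range w \<subseteq> {a', b'}" by (simp add: sturmian_over_def balanced_over_def)
  then have "{a, b} \<subseteq> {a', b'}" using assms(3,4) by blast
  then consider "a = a'" "b = b'" | "a = b'" "b = a'" using assms(2) by auto
  then show ?thesis
    using w balanced_over_swap by cases (auto simp: sturmian_over_def)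
qed

lemma balanced_over_factors:
  assumes "balanced_over a b w"
    and X: "prefix N w = A @ X @ B" and Y: "prefix M w = C @ Y @ D"
    and len: "length X = length Y"
  shows "\<bar>int (count_list X a) - int (count_list Y a)\<bar> \<le> 1"
proof -
  have factor: "X = w [length A \<rightarrow> length A + length X]" if "prefix N w = A @ X @ B" for N A X B
  proof -
    have "N = length A + length X + length B" using arg_cong[OF that, of length] by simp
    moreover have "drop (length A) (take (length A + length X) (prefix N w)) = X"
      unfolding that by simp
    ultimately show ?thesis by simp
  qed
  show ?thesis
    using assms(1) factor[OF X] factor[OF Y] len unfolding balanced_over_def by metis
qed

text \<open>
  The discrepancy of a word over \<open>{0, 1}\<close> against a density \<open>\<alpha>\<close> of the letter 1. It turns
  concatenation into addition.
\<close>

definition disc :: "real \<Rightarrow> nat list \<Rightarrow> real" where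
  "disc \<alpha> u = \<alpha> * real (length u) - real (count_list u 1)"

lemma disc_Nil [simp]: "disc \<alpha> [] = 0"
  by (simp add: disc_def)

lemma disc_append [simp]: "disc \<alpha> (u @ v) = disc \<alpha> u + disc \<alpha> v"
  by (simp add: disc_def algebra_simps)

lemma disc_Cons: "disc \<alpha> (a # u) = (if a = 1 then \<alpha> - 1 else \<alpha>) + disc \<alpha> u"
  by (simp add: disc_def algebra_simps)

lemma disc_list_power: "n \<ge> 0 \<Longrightarrow> disc \<alpha> (list_power u n) = of_int n * disc \<alpha> u"
proof (induction n rule: int_ge_induct)
  case (step n)
  then show ?case by (simp add: list_power_plus_1 distrib_right)
qed simp

lemma disc_split: "disc \<alpha> (w [i \<rightarrow> i + n]) = disc \<alpha> (prefix (i + n) w) - disc \<alpha> (prefix i w)"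
  by (simp add: subsequence_append)

text \<open>
  A word whose prefixes have their discrepancies in an interval of length 1 is a coding of a
  rotation, and hence sturmian if the angle is irrational.
\<close>

lemma sturmian_over_if_bounded_disc:
  assumes range: "range v \<subseteq> {0, 1}" and irr: "\<alpha> \<notin> \<rat>"
    and bound: "\<And>k. L \<le> disc \<alpha> (prefix k v) \<and> disc \<alpha> (prefix k v) \<le> L + 1"
  shows "sturmian_over 0 1 v"
proof -
  let ?ones = "\<lambda>i n. count_list (v [i \<rightarrow> i + n]) 1"
  have not_int: "\<alpha> * real n \<noteq> of_int z" if "n \<ge> 1" for n z
  proof
    assume "\<alpha> * real n = of_int z"
    then have "\<alpha> = of_int z / of_nat n" using that by (simp add: field_simps)
    then show False using irr by simp
  qed
  \<comment> \<open>so factors of length \<open>n\<close> have at most two possible counts, unless \<open>\<alpha>n\<close> is an integer\<close>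
  have near: "\<bar>real (?ones i n) - \<alpha> * real n\<bar> \<le> 1" for i n
    using disc_split[of \<alpha> v i n] bound[of i] bound[of "i + n"]
    by (simp add: disc_def algebra_simps abs_le_iff)
  have diff: "\<bar>int (?ones i n) - int (?ones j n)\<bar> \<le> 1" for n i j
  proof (cases "n = 0")
    case False
    have "real (?ones i n) \<noteq> \<alpha> * real n + 1" "real (?ones i n) \<noteq> \<alpha> * real n - 1"
         "real (?ones j n) \<noteq> \<alpha> * real n + 1" "real (?ones j n) \<noteq> \<alpha> * real n - 1"
      using not_int[of n "int (?ones i n) - 1"] not_int[of n "int (?ones i n) + 1"]
        not_int[of n "int (?ones j n) - 1"] not_int[of n "int (?ones j n) + 1"] False by auto
    then have "\<bar>real (?ones i n) - real (?ones j n)\<bar> < 2"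
      using near[of i n] near[of j n] by linarith
    then show ?thesis by linarith
  qed simp
  have "balanced_over 1 0 v"
    unfolding balanced_over_def using range diff by auto
  then have bal: "balanced_over 0 1 v" by (rule balanced_over_swap)
  have "\<not> eventually_periodic v"
  proof
    assume "eventually_periodic v"
    then obtain n q where q: "q \<ge> 1" and per: "\<And>k. k \<ge> n \<Longrightarrow> v (k + q) = v k"
      by (auto simp: eventually_periodic_def periodic_from_def)
    define \<delta> where "\<delta> = disc \<alpha> (v [n \<rightarrow> n + q])"
    have shift: "v (k + j * q) = v k" if "k \<ge> n" for k j
    proof (induction j)
      case (Suc j)
      then show ?case using per[of "k + j * q"] that by (simp add: ac_simps)
    qed simp
    have block: "v [n + j * q \<rightarrow> n + j * q + q] = v [n \<rightarrow> n + q]" for j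
    proof (rule nth_equalityI)
      fix i assume "i < length (v [n + j * q \<rightarrow> n + j * q + q])"
      then show "v [n + j * q \<rightarrow> n + j * q + q] ! i = v [n \<rightarrow> n + q] ! i"
        using shift[of "n + i" j] by (simp add: ac_simps)
    qed simp
    have lin: "disc \<alpha> (prefix (n + j * q) v) = disc \<alpha> (prefix n v) + real j * \<delta>" for j
    proof (induction j)
      case (Suc j)
      have "disc \<alpha> (prefix (n + Suc j * q) v) = disc \<alpha> (prefix (n + j * q) v) + \<delta>"
        using disc_split[of \<alpha> v "n + j * q" q] block[of j] by (simp add: \<delta>_def ac_simps)
      then show ?case using Suc by (simp add: algebra_simps)
    qed simp
    \<comment> \<open>an integer multiple of the irrational angle is no integer, so the discrepancy drifts away\<close>
    have "\<delta> \<noteq> 0"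
      using not_int[OF q, of "int (?ones n q)"] by (simp add: \<delta>_def disc_def)
    moreover obtain j :: nat where "2 / \<bar>\<delta>\<bar> < real j" using reals_Archimedean2 by blast
    ultimately have "\<bar>real j * \<delta>\<bar> > 2" by (simp add: field_simps abs_mult)
    then show False using lin[of j] bound[of n] bound[of "n + j * q"] by linarith
  qed
  then show ?thesis using bal by (simp add: sturmian_over_def)
qed

text \<open>
  The module \<open>\<int>\<alpha> + \<int>(\<alpha> - 1)\<close> would be discrete for a rational \<open>\<alpha>\<close>, so that no contraction could
  map it into itself.
\<close>

lemma irrational_if_contraction:
  fixes \<alpha> \<gamma> :: real and a b c d :: int
  assumes "0 < \<gamma>" "\<gamma> < 1" "\<alpha> \<noteq> 0"
    and "\<gamma> * \<alpha> = of_int a * \<alpha> + of_int b * (\<alpha> - 1)"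
    and "\<gamma> * (\<alpha> - 1) = of_int c * \<alpha> + of_int d * (\<alpha> - 1)"
  shows "\<alpha> \<notin> \<rat>"
proof
  assume "\<alpha> \<in> \<rat>"
  then obtain s q :: int where q: "q > 0" "\<alpha> = of_int s / of_int q"
    by (auto elim!: Rats_cases')
  have comb: "\<exists>x y :: int. \<gamma> ^ N * \<alpha> = of_int x * \<alpha> + of_int y * (\<alpha> - 1)" for N
  proof (induction N)
    case 0
    show ?case by (rule exI[of _ 1], rule exI[of _ 0]) simp
  next
    case (Suc N)
    then obtain x y :: int where xy: "\<gamma> ^ N * \<alpha> = of_int x * \<alpha> + of_int y * (\<alpha> - 1)" by blast
    have "\<gamma> ^ Suc N * \<alpha> = \<gamma> * (\<gamma> ^ N * \<alpha>)" by simp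
    also have "\<dots> = of_int x * (\<gamma> * \<alpha>) + of_int y * (\<gamma> * (\<alpha> - 1))"
      unfolding xy by (simp add: algebra_simps)
    also have "\<dots> = of_int (x * a + y * c) * \<alpha> + of_int (x * b + y * d) * (\<alpha> - 1)"
      unfolding assms(4,5) by (simp add: algebra_simps)
    finally show ?case by blast
  qed
  obtain N where N: "\<gamma> ^ N < 1 / (of_int q * \<bar>\<alpha>\<bar>)"
    using real_arch_pow_inv[of "1 / (of_int q * \<bar>\<alpha>\<bar>)" \<gamma>] q assms by auto
  obtain x y :: int where xy: "\<gamma> ^ N * \<alpha> = of_int x * \<alpha> + of_int y * (\<alpha> - 1)"
    using comb by blast
  have q\<alpha>: "of_int q * \<alpha> = of_int s" using q by simp
  have "of_int q * (\<gamma> ^ N * \<alpha>) = of_int x * (of_int q * \<alpha>) + of_int y * (of_int q * \<alpha> - of_int q)"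
    unfolding xy by (simp add: algebra_simps)
  then have "of_int q * (\<gamma> ^ N * \<alpha>) = of_int (x * s + y * (s - q))"
    unfolding q\<alpha> by simp
  moreover have "of_int q * (\<gamma> ^ N * \<alpha>) \<noteq> 0"
    using q(1) assms by simp
  ultimately have "\<bar>of_int q * (\<gamma> ^ N * \<alpha>)\<bar> \<ge> 1"
    using of_int_leD[of 1 "x * s + y * (s - q)"] by (metis of_int_0 of_int_eq_iff of_int_abs of_int_1 of_int_le_iff int_one_le_iff_zero_less zero_less_abs_iff)
  moreover have "\<bar>of_int q * (\<gamma> ^ N * \<alpha>)\<bar> = \<gamma> ^ N * (of_int q * \<bar>\<alpha>\<bar>)"
    using q(1) assms by (simp add: abs_mult)
  moreover have "\<gamma> ^ N * (of_int q * \<bar>\<alpha>\<bar>) < 1"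
    using N q(1) assms by (simp add: field_simps)
  ultimately show False by linarith
qed

section \<open>Fixed words of two families of substitutions are sturmian\<close>

text \<open>
  In the coding of the rotation by \<open>\<alpha>\<close> on \<open>[L, L + 1]\<close>, the points followed by the letter 0 form the
  left interval, of length \<open>1 - \<alpha>\<close>, and those followed by 1 the right interval.
\<close>

definition letter_interval :: "real \<Rightarrow> real \<Rightarrow> nat \<Rightarrow> real set" where
  "letter_interval \<alpha> L a = (if a = 0 then {L..L + 1 - \<alpha>} else {L + 1 - \<alpha>..L + 1})"

text \<open>
  The finite word \<open>u\<close> codes the orbit of the point \<open>D\<close>: each letter is read from a point of its interval,
  and reading a letter moves the point by the discrepancy of the letter. Closed intervals are good
  enough, since for an irrational angle no factor attains the discrepancy 1 or -1.
\<close>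

definition codes :: "real \<Rightarrow> real \<Rightarrow> real \<Rightarrow> nat list \<Rightarrow> bool" where
  "codes \<alpha> L D u \<longleftrightarrow> (\<forall>j<length u. D + disc \<alpha> (take j u) \<in> letter_interval \<alpha> L (u ! j))"

lemma codes_append:
  assumes "codes \<alpha> L D u" "codes \<alpha> L (D + disc \<alpha> u) v"
  shows "codes \<alpha> L D (u @ v)"
  unfolding codes_def
proof (intro allI impI)
  fix j assume j: "j < length (u @ v)"
  show "D + disc \<alpha> (take j (u @ v)) \<in> letter_interval \<alpha> L ((u @ v) ! j)"
  proof (cases "j < length u")
    case True
    then show ?thesis using assms(1) by (simp add: codes_def nth_append)
  next
    case False
    then show ?thesis
      using assms(2) j by (auto simp: codes_def nth_append algebra_simps)
  qed
qed

lemma codes_singleton: "codes \<alpha> L D [a] \<longleftrightarrow> D \<in> letter_interval \<alpha> L a"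
  by (simp add: codes_def)

lemma codes_list_power:
  assumes "n \<ge> 0" "\<And>i. 0 \<le> i \<Longrightarrow> i < n \<Longrightarrow> codes \<alpha> L (D + of_int i * disc \<alpha> u) u"
  shows "codes \<alpha> L D (list_power u n)"
  using assms
proof (induction n rule: int_ge_induct)
  case base
  then show ?case by (simp add: codes_def)
next
  case (step n)
  then show ?case
    by (auto simp: list_power_plus_1 disc_list_power intro!: codes_append)
qed

lemma codes_zeros_one:
  assumes "m \<ge> 0" "0 \<le> \<alpha>" "L \<le> D" "L + 1 - \<alpha> \<le> D + of_int m * \<alpha>" "D + of_int m * \<alpha> \<le> L + 1"
  shows "codes \<alpha> L D (list_power [0] m @ [1])"
proof (rule codes_append)
  show "codes \<alpha> L D (list_power [0] m)"
  proof (rule codes_list_power[OF assms(1)])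
    fix i assume i: "0 \<le> i" "i < m"
    have "0 \<le> of_int i * \<alpha>" using i(1) assms(2) by simp
    moreover have "of_int (i + 1) * \<alpha> \<le> of_int m * \<alpha>"
      using i(2) assms(2) by (intro mult_right_mono) auto
    ultimately show "codes \<alpha> L (D + of_int i * disc \<alpha> [0]) [0]"
      using assms(3,5) by (simp add: codes_singleton letter_interval_def disc_Cons algebra_simps)
  qed
  show "codes \<alpha> L (D + disc \<alpha> (list_power [0] m)) [1]"
    using assms by (simp add: codes_singleton letter_interval_def disc_list_power disc_Cons)
qed

text \<open>
  If a substitution multiplies discrepancies by \<open>\<gamma>\<close> and the image of a letter, read from \<open>\<gamma>D\<close>, codes
  the rotation whenever the letter can be read from \<open>D\<close>, then its fixed word codes the rotation.
\<close>

lemma fixed_word_codes: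
  assumes fixed: "fixed_by_subst (subst01 s0 s1) v" and range: "range v \<subseteq> {0, 1}"
    and v0: "v 0 = 0" and len: "length s0 \<ge> 2" "s1 \<noteq> []"
    and start: "0 \<in> letter_interval \<alpha> L 0"
    and contr: "disc \<alpha> s0 = \<gamma> * \<alpha>" "disc \<alpha> s1 = \<gamma> * (\<alpha> - 1)"
    and s0: "\<And>D. D \<in> letter_interval \<alpha> L 0 \<Longrightarrow> codes \<alpha> L (\<gamma> * D) s0"
    and s1: "\<And>D. D \<in> letter_interval \<alpha> L 1 \<Longrightarrow> codes \<alpha> L (\<gamma> * D) s1"
  shows "disc \<alpha> (prefix n v) \<in> letter_interval \<alpha> L (v n)"
proof (induction n rule: less_induct)
  case (less n)
  define \<sigma> where "\<sigma> = subst01 s0 s1"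
  define l where "l m = length (subst_list \<sigma> (prefix m v))" for m
  have ne: "\<sigma> a \<noteq> []" for a using len by (auto simp: \<sigma>_def subst01_def)
  have disc\<sigma>: "disc \<alpha> (subst_list \<sigma> u) = \<gamma> * disc \<alpha> u" if "set u \<subseteq> {0, 1}" for u
    using that by (induction u) (auto simp: disc_Cons contr \<sigma>_def algebra_simps)
  have pre: "subst_list \<sigma> (prefix m v) = prefix (l m) v" for m
    using fixed_by_substD[OF fixed] unfolding \<sigma>_def l_def by simp
  show ?case
  proof (cases "n = 0")
    case True
    then show ?thesis using v0 start by simp
  next
    case False
    have grow: "l m > m" if "m \<ge> 1" for m
    proof -
      have "prefix m v = 0 # map v [1..<m]"
        using v0 that by (simp add: subsequence_def upt_conv_Cons)
      then have "l m = length s0 + length (subst_list \<sigma> (map v [1..<m]))"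
        by (simp add: l_def \<sigma>_def)
      then show ?thesis
        using len(1) that length_subst_list_ge[of \<sigma> "map v [1..<m]", OF ne] by simp
    qed
    \<comment> \<open>the position \<open>n\<close> lies in the image of the \<open>m\<close>-th letter\<close>
    define m where "m = (LEAST m. n < l (Suc m))"
    have ex: "n < l (Suc n)" using grow[of "Suc n"] by simp
    have m1: "n < l (Suc m)" unfolding m_def by (rule LeastI, rule ex)
    have m2: "l m \<le> n"
    proof (cases m)
      case 0
      then show ?thesis by (simp add: l_def)
    next
      case (Suc m')
      then have "\<not> n < l (Suc m')" unfolding m_def by (metis lessI not_less_Least)
      then show ?thesis using Suc by simp
    qed
    have mn: "m < n"
      using grow[of m] m2 False by (cases "m = 0") auto
    have lS: "l (Suc m) = l m + length (\<sigma> (v m))"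
      by (simp add: l_def)
    define j where "j = n - l m"
    have j: "j < length (\<sigma> (v m))" "n = l m + j" using m1 m2 lS by (auto simp: j_def)
    have eqS: "prefix (l (Suc m)) v = prefix (l m) v @ \<sigma> (v m)"
      using pre[of "Suc m"] pre[of m] by simp
    have len_l: "length (prefix (l m) v) = l m" by simp
    have vn: "v n = \<sigma> (v m) ! j"
    proof -
      have "v n = prefix (l (Suc m)) v ! n" using m1 by simp
      also have "\<dots> = \<sigma> (v m) ! j"
        unfolding eqS using j(2) len_l by (simp add: nth_append)
      finally show ?thesis .
    qed
    have "prefix n v = take n (prefix (l (Suc m)) v)"
      using m1 by (intro prefix_eq_take) simp
    also have "\<dots> = prefix (l m) v @ take j (\<sigma> (v m))"
      unfolding eqS using j(2) len_l by (simp del: subsequence_take)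
    finally have "prefix n v = prefix (l m) v @ take j (\<sigma> (v m))" .
    then have dn: "disc \<alpha> (prefix n v) = \<gamma> * disc \<alpha> (prefix m v) + disc \<alpha> (take j (\<sigma> (v m)))"
      using disc\<sigma>[of "prefix m v"] range unfolding pre by (simp add: subset_eq image_subset_iff)
    have "codes \<alpha> L (\<gamma> * disc \<alpha> (prefix m v)) (\<sigma> (v m))"
    proof -
      have "v m = 0 \<or> v m = 1" using range by auto
      then show ?thesis using less[OF mn] s0 s1 by (auto simp: \<sigma>_def)
    qed
    then show ?thesis using j(1) dn vn by (simp add: codes_def)
  qed
qed

lemma sturmian_if_letter_interval:
  assumes "range v \<subseteq> {0, 1}" "\<alpha> \<notin> \<rat>" "0 \<le> \<alpha>" "\<alpha> \<le> 1"
    and "\<And>n. disc \<alpha> (prefix n v) \<in> letter_interval \<alpha> L (v n)"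
  shows "sturmian_over 0 1 v"
proof (rule sturmian_over_if_bounded_disc[OF assms(1,2)])
  fix k
  show "L \<le> disc \<alpha> (prefix k v) \<and> disc \<alpha> (prefix k v) \<le> L + 1"
    using assms(3,4) assms(5)[of k] by (auto simp: letter_interval_def split: if_splits)
qed

text \<open>
  The abelianized substitution has the eigenvalues \<open>\<gamma>\<close> and \<open>1/\<gamma>\<close>; \<open>\<alpha>\<close> is the frequency of the letter 1
  in its dominant eigenvector, so that the substitution multiplies \<open>disc \<alpha>\<close> by \<open>\<gamma>\<close>. The conditions for reading
  the images inside \<open>[L, L + 1]\<close> leave \<open>L = - \<alpha>\<close> as the only choice.
\<close>

lemma sturmian_fixed_word_blocks:
  fixes d e :: int and \<gamma> :: real
  assumes d: "d \<ge> 1" and e: "e \<ge> 1" and \<gamma>: "0 < \<gamma>" "\<gamma> < 1" "\<gamma>\<^sup>2 + 1 = of_int (d * e + 2) * \<gamma>"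
    and range: "range v \<subseteq> {0, 1}"
    and fixed: "fixed_by_subst (subst01 (list_power (list_power [0] e @ [1]) d @ [0])
                                        (list_power [0] e @ [1])) v"
    and v0: "v 0 = 0"
  shows "sturmian_over 0 1 v"
proof -
  define \<alpha> where "\<alpha> = (1 - \<gamma>) / (of_int e + 1 - \<gamma>)"
  define u where "u = list_power [0::nat] e @ [1]"
  define \<delta> where "\<delta> = disc \<alpha> u"
  have e': "real_of_int e \<ge> 1" and d': "real_of_int d \<ge> 1" using d e by simp_all
  have den: "of_int e + 1 - \<gamma> > 0" using e' \<gamma>(2) by linarith
  have \<alpha>eq: "\<alpha> * (of_int e + 1 - \<gamma>) = 1 - \<gamma>" using den by (simp add: \<alpha>_def)
  have \<alpha>0: "\<alpha> > 0" using den \<gamma>(2) by (simp add: \<alpha>_def)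
  have "1 - \<gamma> \<le> of_int e" using e' \<gamma>(1) by simp
  then have "2 * (1 - \<gamma>) \<le> of_int e + 1 - \<gamma>" by simp
  then have \<alpha>2: "2 * \<alpha> \<le> 1" using den by (simp add: \<alpha>_def field_simps)
  have "\<delta> = (of_int e + 1) * \<alpha> - 1"
    using e by (simp add: \<delta>_def u_def disc_list_power disc_Cons algebra_simps)
  then have \<delta>: "\<delta> = - \<gamma> * (1 - \<alpha>)" using \<alpha>eq by (simp add: algebra_simps)
  have d\<delta>: "of_int d * \<delta> = - (1 - \<gamma>) * \<alpha>"
  proof -
    have "1 - \<alpha> = of_int e / (of_int e + 1 - \<gamma>)"
      using den by (simp add: \<alpha>_def field_simps)
    then have "of_int d * \<delta> = - (of_int (d * e) * \<gamma>) / (of_int e + 1 - \<gamma>)"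
      unfolding \<delta> by simp
    also have "of_int (d * e) * \<gamma> = (1 - \<gamma>) * (1 - \<gamma>)"
      using \<gamma>(3) by (simp add: algebra_simps power2_eq_square)
    finally show ?thesis by (simp add: \<alpha>_def minus_divide_left algebra_simps)
  qed
  have \<delta>neg: "\<delta> < 0" using \<delta> \<gamma>(1) \<alpha>0 \<alpha>2 by simp
  have contr: "disc \<alpha> (list_power u d @ [0]) = \<gamma> * \<alpha>" "disc \<alpha> u = \<gamma> * (\<alpha> - 1)"
  proof -
    show "disc \<alpha> (list_power u d @ [0]) = \<gamma> * \<alpha>"
      using d d\<delta> by (simp add: disc_list_power disc_Cons \<delta>_def[symmetric] algebra_simps)
    show "disc \<alpha> u = \<gamma> * (\<alpha> - 1)"
      using \<delta> by (simp add: \<delta>_def[symmetric] algebra_simps)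
  qed
  have irr: "\<alpha> \<notin> \<rat>"
  proof (rule irrational_if_contraction[OF \<gamma>(1,2)])
    show "\<alpha> \<noteq> 0" using \<alpha>0 by simp
    show "\<gamma> * \<alpha> = of_int (d * e + 1) * \<alpha> + of_int d * (\<alpha> - 1)"
      using contr(1) d e
      by (simp add: u_def disc_list_power disc_Cons algebra_simps)
    show "\<gamma> * (\<alpha> - 1) = of_int e * \<alpha> + of_int 1 * (\<alpha> - 1)"
      using contr(2) e by (simp add: u_def disc_list_power disc_Cons)
  qed
  have block: "codes \<alpha> (- \<alpha>) D u" if "- \<alpha> - \<delta> \<le> D" "D \<le> - \<delta>" for D
    unfolding u_def
  proof (rule codes_zeros_one)
    have \<delta>': "\<delta> = of_int e * \<alpha> + \<alpha> - 1"
      using \<open>\<delta> = (of_int e + 1) * \<alpha> - 1\<close> by (simp add: algebra_simps)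
    show "0 \<le> e" "0 \<le> \<alpha>" using e \<alpha>0 by auto
    show "- \<alpha> \<le> D" using that(1) \<delta>neg by linarith
    show "- \<alpha> + 1 - \<alpha> \<le> D + of_int e * \<alpha>" "D + of_int e * \<alpha> \<le> - \<alpha> + 1"
      using that \<delta>' by linarith+
  qed
  have "disc \<alpha> (prefix n v) \<in> letter_interval \<alpha> (- \<alpha>) (v n)" for n
  proof (rule fixed_word_codes[OF fixed[folded u_def] range v0 _ _ _ contr])
    have "length (list_power u d) \<ge> 1"
      using d list_power_1_plus[of "d - 1" u] by (simp add: u_def)
    then show "length (list_power u d @ [0]) \<ge> 2" by simp
    show "u \<noteq> []" by (simp add: u_def)
    show "0 \<in> letter_interval \<alpha> (- \<alpha>) 0"
      using \<alpha>0 \<alpha>2 by (simp add: letter_interval_def)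
  next
    fix D assume "D \<in> letter_interval \<alpha> (- \<alpha>) 0"
    then have D: "- \<alpha> \<le> D" "D \<le> 1 - 2 * \<alpha>" by (simp_all add: letter_interval_def)
    have gD: "- (\<gamma> * \<alpha>) \<le> \<gamma> * D" "\<gamma> * D \<le> \<gamma> * (1 - 2 * \<alpha>)"
      using D \<gamma>(1) mult_left_mono[of "- \<alpha>" D \<gamma>] mult_left_mono[of D "1 - 2 * \<alpha>" \<gamma>] by simp_all
    show "codes \<alpha> (- \<alpha>) (\<gamma> * D) (list_power u d @ [0])"
    proof (rule codes_append)
      show "codes \<alpha> (- \<alpha>) (\<gamma> * D) (list_power u d)"
      proof (rule codes_list_power)
        show "d \<ge> 0" using d by simp
        fix i assume i: "0 \<le> i" "i < d"
        have "of_int (i + 1) * \<delta> \<ge> of_int d * \<delta>"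
          using i \<delta>neg by (intro mult_right_mono_neg) auto
        then have l: "of_int i * \<delta> + \<delta> \<ge> of_int d * \<delta>" by (simp add: algebra_simps)
        have u: "of_int i * \<delta> \<le> 0" using i \<delta>neg by (simp add: mult_nonneg_nonpos)
        show "codes \<alpha> (- \<alpha>) (\<gamma> * D + of_int i * disc \<alpha> u) u"
        proof (rule block)
          show "- \<alpha> - \<delta> \<le> \<gamma> * D + of_int i * disc \<alpha> u"
            using gD(1) l d\<delta> by (simp add: \<delta>_def[symmetric] algebra_simps)
          have "\<gamma> * (1 - 2 * \<alpha>) \<le> \<gamma> * (1 - \<alpha>)" using \<gamma>(1) \<alpha>0 by simp
          then show "\<gamma> * D + of_int i * disc \<alpha> u \<le> - \<delta>"
            using gD(2) u \<delta> by (simp add: \<delta>_def[symmetric])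
        qed
      qed
      have "\<gamma> * (1 - 2 * \<alpha>) \<le> 1 * (1 - 2 * \<alpha>)" using \<gamma> \<alpha>2 by (intro mult_right_mono) auto
      moreover have "of_int d * \<delta> \<le> 0" using d \<delta>neg by (simp add: mult_nonneg_nonpos)
      ultimately show "codes \<alpha> (- \<alpha>) (\<gamma> * D + disc \<alpha> (list_power u d)) [0]"
        using gD d d\<delta>
        by (simp add: codes_singleton letter_interval_def disc_list_power \<delta>_def[symmetric] algebra_simps)
    qed
  next
    fix D assume "D \<in> letter_interval \<alpha> (- \<alpha>) 1"
    then have D: "1 - 2 * \<alpha> \<le> D" "D \<le> 1 - \<alpha>" by (simp_all add: letter_interval_def)
    show "codes \<alpha> (- \<alpha>) (\<gamma> * D) u"
    proof (rule block)
      have "\<gamma> * \<alpha> \<le> 1 * \<alpha>" using \<gamma> \<alpha>0 by (intro mult_right_mono) auto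
      then show "- \<alpha> - \<delta> \<le> \<gamma> * D"
        using mult_left_mono[OF D(1), of \<gamma>] \<gamma>(1) \<delta> by (simp add: algebra_simps)
      show "\<gamma> * D \<le> - \<delta>" using mult_left_mono[OF D(2), of \<gamma>] \<gamma>(1) \<delta> by simp
    qed
  qed
  then show ?thesis
    using sturmian_if_letter_interval[OF range irr, of "- \<alpha>"] \<alpha>0 \<alpha>2 by simp
qed

text \<open>
  Here the frequency of the letter 1 is the contracting eigenvalue \<open>\<gamma>\<close> itself, and the interval is
  \<open>[0, 1]\<close>.
\<close>

lemma sturmian_fixed_word_zeros_one:
  fixes d :: int and \<gamma> :: real
  assumes d: "d \<ge> 1" and \<gamma>: "0 < \<gamma>" "\<gamma> < 1" "\<gamma>\<^sup>2 + 1 = of_int (d + 2) * \<gamma>"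
    and range: "range v \<subseteq> {0, 1}"
    and fixed: "fixed_by_subst (subst01 (list_power [0] (d + 1) @ [1]) (list_power [0] d @ [1])) v"
    and v0: "v 0 = 0"
  shows "sturmian_over 0 1 v"
proof -
  have d\<gamma>: "of_int d * \<gamma> = 1 - 2 * \<gamma> + \<gamma>\<^sup>2"
    using \<gamma>(3) by (simp add: algebra_simps)
  have contr: "disc \<gamma> (list_power [0] (d + 1) @ [1]) = \<gamma> * \<gamma>"
    "disc \<gamma> (list_power [0] d @ [1]) = \<gamma> * (\<gamma> - 1)"
    using d d\<gamma> by (simp_all add: disc_list_power disc_Cons algebra_simps power2_eq_square)
  have irr: "\<gamma> \<notin> \<rat>"
  proof (rule irrational_if_contraction[OF \<gamma>(1,2)])
    show "\<gamma> \<noteq> 0" using \<gamma>(1) by simp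
    show "\<gamma> * \<gamma> = of_int (d + 1) * \<gamma> + of_int 1 * (\<gamma> - 1)"
      "\<gamma> * (\<gamma> - 1) = of_int d * \<gamma> + of_int 1 * (\<gamma> - 1)"
      using contr d by (simp_all add: disc_list_power disc_Cons algebra_simps)
  qed
  have g2: "\<gamma>\<^sup>2 \<le> \<gamma>" using \<gamma> by (simp add: power2_eq_square)
  have "disc \<gamma> (prefix n v) \<in> letter_interval \<gamma> 0 (v n)" for n
  proof (rule fixed_word_codes[OF fixed range v0 _ _ _ contr])
    show "length (list_power [0::nat] (d + 1) @ [1]) \<ge> 2"
      using d by (simp add: list_power_letter)
    show "list_power [0::nat] d @ [1] \<noteq> []" by simp
    show "0 \<in> letter_interval \<gamma> 0 0" using \<gamma> by (simp add: letter_interval_def)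
  next
    fix D assume "D \<in> letter_interval \<gamma> 0 0"
    then have D: "0 \<le> D" "D \<le> 1 - \<gamma>" by (simp_all add: letter_interval_def)
    show "codes \<gamma> 0 (\<gamma> * D) (list_power [0] (d + 1) @ [1])"
    proof (rule codes_zeros_one)
      show "0 \<le> d + 1" "0 \<le> \<gamma>" "0 \<le> \<gamma> * D" using d \<gamma> D by simp_all
      have eq: "of_int (d + 1) * \<gamma> = 1 - \<gamma> + \<gamma>\<^sup>2" using d\<gamma> by (simp add: algebra_simps)
      show "0 + 1 - \<gamma> \<le> \<gamma> * D + of_int (d + 1) * \<gamma>"
        unfolding eq using \<gamma>(1) D(1) by simp
      show "\<gamma> * D + of_int (d + 1) * \<gamma> \<le> 0 + 1"
        unfolding eq using mult_left_mono[OF D(2), of \<gamma>] \<gamma>(1)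
        by (simp add: algebra_simps power2_eq_square)
    qed
  next
    fix D assume "D \<in> letter_interval \<gamma> 0 1"
    then have D: "1 - \<gamma> \<le> D" "D \<le> 1" by (simp_all add: letter_interval_def)
    show "codes \<gamma> 0 (\<gamma> * D) (list_power [0] d @ [1])"
    proof (rule codes_zeros_one)
      show "0 \<le> d" "0 \<le> \<gamma>" "0 \<le> \<gamma> * D" using d \<gamma> D by simp_all
      show "0 + 1 - \<gamma> \<le> \<gamma> * D + of_int d * \<gamma>"
        unfolding d\<gamma> using mult_left_mono[OF D(1), of \<gamma>] \<gamma>(1)
        by (simp add: algebra_simps power2_eq_square)
      show "\<gamma> * D + of_int d * \<gamma> \<le> 0 + 1"
      proof -
        have "\<gamma> * D \<le> \<gamma>" using D(2) \<gamma>(1) by simp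
        then show ?thesis unfolding d\<gamma> using g2 by linarith
      qed
    qed
  qed
  then show ?thesis
    using sturmian_if_letter_interval[OF range irr, of 0] \<gamma> by simp
qed

section \<open>Words built by block recursions\<close>

lemma list_power_Cons: "n \<ge> 1 \<Longrightarrow> list_power u n = u @ list_power u (n - 1)"
  using list_power_1_plus[of "n - 1" u] by simp

lemma list_power_snoc: "n \<ge> 1 \<Longrightarrow> list_power u n = list_power u (n - 1) @ u"
  using list_power_plus_1[of "n - 1" u] by simp

lemma list_power_commute: "n \<ge> 0 \<Longrightarrow> list_power u n @ u = u @ list_power u n"
  by (metis list_power_1_plus list_power_plus_1)

lemma length_list_power: "length (list_power u n) = nat n * length u"
  by (simp add: list_power_def length_concat sum_list_replicate)

lemma balanced_over_block_factors:
  assumes "balanced_over a b v" "\<And>N. prefix (length (V N)) v = V N"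
    and "V N = A @ X @ B" "V M = C @ Y @ D" "length X = length Y"
  shows "\<bar>int (count_list X a) - int (count_list Y a)\<bar> \<le> 1"
  by (rule balanced_over_factors[OF assms(1) trans[OF assms(2,3)] trans[OF assms(2,4)] assms(5)])

text \<open>
  The recursion of the blocks when all quasi-greedy expansions have period 2 and no preperiod: those
  of the even levels are \<open>(d e)\<^sup>\<omega>\<close>, those of the odd levels are \<open>(f g)\<^sup>\<omega>\<close>.
  The last factor \<open>V\<^sub>N\<close> gathers what follows the first two digits.
\<close>

definition two_periodic_blocks ::
    "int \<Rightarrow> int \<Rightarrow> int \<Rightarrow> int \<Rightarrow> (nat \<Rightarrow> nat list) \<Rightarrow> bool" where
  "two_periodic_blocks d e f g V \<longleftrightarrow> V 0 = [0] \<and> V 1 = list_power [0] f @ [1] \<and>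
     (\<forall>N. V (N + 2) = (if even N then list_power (V (N + 1)) d @ list_power (V N) e @ V N
                       else list_power (V (N + 1)) f @ list_power (V N) g @ V N))"

lemma two_periodic_blocksD:
  assumes "two_periodic_blocks d e f g V"
  shows "V 0 = [0]" "V 1 = list_power [0] f @ [1]"
    "V 2 = list_power (V 1) d @ list_power [0] e @ [0]"
    "V 3 = list_power (V 2) f @ list_power (V 1) g @ V 1"
    "V 4 = list_power (V 3) d @ list_power (V 2) e @ V 2"
    "V 5 = list_power (V 4) f @ list_power (V 3) g @ V 3"
proof -
  have step: "V (N + 2) = (if even N then list_power (V (N + 1)) d @ list_power (V N) e @ V N
      else list_power (V (N + 1)) f @ list_power (V N) g @ V N)" for N
    using assms by (simp add: two_periodic_blocks_def)
  show "V 0 = [0]" and V1: "V 1 = list_power [0] f @ [1]"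
    using assms by (simp_all add: two_periodic_blocks_def)
  then show "V 2 = list_power (V 1) d @ list_power [0] e @ [0]"
    using step[of 0] by (simp add: numeral_2_eq_2)
  show "V 3 = list_power (V 2) f @ list_power (V 1) g @ V 1" using step[of 1] by (simp add: eval_nat_numeral)
  show "V 4 = list_power (V 3) d @ list_power (V 2) e @ V 2" using step[of 2] by (simp add: eval_nat_numeral)
  show "V 5 = list_power (V 4) f @ list_power (V 3) g @ V 3" using step[of 3] by simp
qed

text \<open>
  A nonzero second digit leads to two factors of equal length that differ by 2 in their numbers of
  zeros: \<open>0\<^bsup>f+2\<^esup>\<close> and \<open>1 0\<^sup>f 1\<close> if \<open>e \<ge> 1\<close>; and, with \<open>a = 0\<^sup>f 1\<close>, \<open>1 a\<^sup>d a\<close> and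
  \<open>0 a\<^sup>d 0 0\<^sup>f\<close> if \<open>e = 0\<close> and \<open>g \<ge> 1\<close>.
\<close>

lemma second_digit_zero_if_balanced:
  assumes V: "two_periodic_blocks d e f g V"
    and digits: "d \<ge> 1" "f \<ge> 1" "e \<ge> 0" "g \<ge> 0"
    and pre: "\<And>N. prefix (length (V N)) v = V N"
    and bal: "balanced_over 0 1 v"
  shows "e = 0 \<and> g = 0"
proof (rule ccontr)
  note Vs = two_periodic_blocksD[OF V]
  define z where "z = list_power [0::nat] f"
  define a where "a = z @ [1]"
  have V1: "V 1 = a" unfolding a_def z_def by (rule Vs(2))
  have V2: "V 2 = a @ list_power a (d - 1) @ list_power [0] e @ [0]"
    using list_power_Cons[OF digits(1), of a] unfolding Vs(3) V1 by simp
  have V3: "V 3 = list_power (V 2) f @ a @ list_power a g"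
    unfolding Vs(4) V1 using list_power_commute[OF digits(4), of a] by simp
  assume neq: "\<not> (e = 0 \<and> g = 0)"
  show False
  proof (cases "e \<ge> 1")
    case True
    have X: "V 3 = (list_power (V 2) (f - 1) @ a @ list_power a (d - 1) @ list_power [0] (e - 1))
        @ ([0, 0] @ z) @ ([1] @ list_power a g)"
      unfolding V3 list_power_snoc[OF digits(2), of "V 2"] using V2 list_power_snoc[OF True, of "[0]"]
      by (simp add: a_def)
    define K L M where "K = list_power (V 2) f" and "L = list_power (V 3) (d - 1)"
      and "M = list_power (V 2) e"
    have Y: "V 4 = (L @ K @ list_power a g @ z)
        @ ([1] @ z @ [1]) @ (list_power a (d - 1) @ list_power [0] e @ [0] @ M)"
    proof -
      have "V 4 = L @ V 3 @ V 2 @ M"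
        unfolding Vs(5) list_power_snoc[OF digits(1), of "V 3"] L_def M_def
        using list_power_commute[OF digits(3), of "V 2"] by simp
      moreover have "V 3 = K @ list_power a g @ z @ [1]"
        unfolding Vs(4) V1 K_def by (simp add: a_def)
      moreover have "V 2 = z @ [1] @ list_power a (d - 1) @ list_power [0] e @ [0]"
        by (subst V2) (simp add: a_def)
      ultimately show ?thesis by simp
    qed
    have "\<bar>int (count_list ([0, 0] @ z) 0) - int (count_list ([1] @ z @ [1]) 0)\<bar> \<le> 1"
      by (rule balanced_over_block_factors[where V = V, OF bal pre X Y]) simp
    then show False by simp
  next
    case False
    then have e: "e = 0" and g: "g \<ge> 1" using digits neq by auto
    have V2': "V 2 = list_power a d @ [0]"
      unfolding Vs(3) V1 e by simp
    have V4: "V 4 = list_power (V 3) (d - 1) @ V 3 @ V 2"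
      unfolding Vs(5) e list_power_snoc[OF digits(1), of "V 3"] by simp
    have V5: "V 5 = list_power (V 4) (f - 1) @ list_power (V 3) (d - 1) @ V 3 @ V 2 @ V 3 @ list_power (V 3) g"
      unfolding Vs(6) list_power_snoc[OF digits(2), of "V 4"]
      using V4 list_power_commute[OF digits(4), of "V 3"] by simp
    have X: "V 4 = (list_power (V 3) (d - 1) @ list_power (V 2) f @ list_power a (g - 1) @ z)
        @ ([1] @ list_power a d @ a) @ [0]"
    proof -
      have "V 3 = list_power (V 2) f @ list_power a (g - 1) @ a @ a"
        unfolding Vs(4) V1 list_power_snoc[OF g, of a] by simp
      moreover have "a @ list_power a d = list_power a d @ a"
        using list_power_commute[of d a] digits by simp
      ultimately show ?thesis unfolding V4 V2' by (simp add: a_def)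
    qed
    obtain G where "list_power (V 2) (f - 1) @ a = z @ G"
    proof (cases "f = 1")
      case True
      then show ?thesis using that[of "[1]"] by (simp add: a_def)
    next
      case False
      then have "list_power (V 2) (f - 1) = V 2 @ list_power (V 2) (f - 1 - 1)"
        using digits by (intro list_power_Cons) simp
      moreover have "V 2 = z @ [1] @ list_power a (d - 1) @ list_power [0] e @ [0]"
        by (subst V2) (simp add: a_def)
      ultimately show ?thesis using that by simp
    qed
    then have "V 3 = V 2 @ z @ G @ list_power a g"
      unfolding V3 list_power_Cons[OF digits(2), of "V 2"] by simp
    then have Y: "V 5 = (list_power (V 4) (f - 1) @ list_power (V 3) (d - 1) @ V 3 @ list_power a d)
        @ ([0] @ list_power a d @ [0] @ z) @ (G @ list_power a g @ list_power (V 3) g)"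
      using V5 by (simp add: V2')
    have "\<bar>int (count_list ([1] @ list_power a d @ a) 0)
        - int (count_list ([0] @ list_power a d @ [0] @ z) 0)\<bar> \<le> 1"
      by (rule balanced_over_block_factors[where V = V, OF bal pre X Y]) (simp add: a_def)
    then show False by (simp add: a_def)
  qed
qed

lemma two_periodic_blocks_fixed:
  assumes V: "two_periodic_blocks d 0 f 0 V"
    and digits: "d \<ge> 1" "f \<ge> 1"
    and pre: "\<And>N. prefix (length (V N)) v = V N" and len: "\<And>N. N \<le> length (V N)"
  shows "fixed_by_subst (subst01 (list_power (list_power [0] f @ [1]) d @ [0])
                                  (list_power [0] f @ [1])) v"
    (is "fixed_by_subst ?\<sigma> v")
proof (rule fixed_by_subst_if_prefixes[OF _ pre])
  show "?\<sigma> a \<noteq> []" for a by (simp add: subst01_def)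
  show "\<exists>N. k \<le> length (V N)" for k using len by blast
  have step: "V (N + 2) = (if even N then list_power (V (N + 1)) d @ V N
      else list_power (V (N + 1)) f @ V N)" for N
    using V by (simp add: two_periodic_blocks_def)
  note Vs = two_periodic_blocksD[OF V]
  show "subst_list ?\<sigma> (V N) = V (N + 2)" for N
  proof (induction N rule: less_induct)
    case (less N)
    consider "N = 0" | "N = 1" | M where "N = M + 2"
      by (metis One_nat_def add_2_eq_Suc' not0_implies_Suc)
    then show ?case
    proof cases
      case 1
      then show ?thesis using Vs(1,2,3) by (simp add: numeral_2_eq_2)
    next
      case 2
      have "subst_list ?\<sigma> (V 1) = list_power (V 2) f @ V 1"
        using Vs(1,2,3) by (simp add: subst_list_power)
      then show ?thesis using Vs(4) 2 by (simp add: numeral_3_eq_3)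
    next
      case 3
      then show ?thesis
        using less[of M] less[of "M + 1"] step[of M] step[of "M + 2"]
        by (simp add: subst_list_power)
    qed
  qed
qed

text \<open>
  For equal digits the substitution of the preceding lemma is the square of a simpler one, which fixes
  the same word.
\<close>

lemma two_periodic_blocks_fixed_equal:
  assumes V: "two_periodic_blocks d 0 d 0 V"
    and pre: "\<And>N. prefix (length (V N)) v = V N" and len: "\<And>N. N \<le> length (V N)"
  shows "fixed_by_subst (subst01 (list_power [0] d @ [1]) [0]) v"
    (is "fixed_by_subst ?\<sigma> v")
proof (rule fixed_by_subst_if_prefixes[OF _ pre])
  show "?\<sigma> a \<noteq> []" for a by (simp add: subst01_def)
  show "\<exists>N. k \<le> length (V N)" for k using len by blast
  have step: "V (N + 2) = list_power (V (N + 1)) d @ V N" for N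
    using V by (simp add: two_periodic_blocks_def)
  note Vs = two_periodic_blocksD[OF V]
  show "subst_list ?\<sigma> (V N) = V (N + 1)" for N
  proof (induction N rule: less_induct)
    case (less N)
    consider "N = 0" | "N = 1" | M where "N = M + 2"
      by (metis One_nat_def add_2_eq_Suc' not0_implies_Suc)
    then show ?case
    proof cases
      case 1
      then show ?thesis using Vs(1,2) by simp
    next
      case 2
      then show ?thesis using Vs(1,2,3) by (simp add: subst_list_power eval_nat_numeral)
    next
      case 3
      then show ?thesis
        using less[of M] less[of "M + 1"] step[of M] step[of "M + 1"]
        by (simp add: subst_list_power eval_nat_numeral)
    qed
  qed
qed

text \<open>
  The recursion of the blocks when all quasi-greedy expansions are equal to \<open>a b\<^sup>\<omega>\<close>. The words
  \<open>Y\<^sub>N\<close> are what follows the power of \<open>V\<^sub>N\<close> in \<open>V\<^bsub>N+1\<^esub>\<close>.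
\<close>

definition preperiodic_blocks ::
    "int \<Rightarrow> int \<Rightarrow> (nat \<Rightarrow> nat list) \<Rightarrow> (nat \<Rightarrow> nat list) \<Rightarrow> bool" where
  "preperiodic_blocks a b V Y \<longleftrightarrow> V 0 = [0] \<and> Y 0 = [1] \<and>
     (\<forall>N. V (Suc N) = list_power (V N) a @ Y N \<and> Y (Suc N) = list_power (V N) b @ Y N)"

text \<open>
  If \<open>a\<close> exceeded \<open>b + 1\<close>, then \<open>0\<^sup>b 0 0\<close> and \<open>1 0\<^sup>b 1\<close> would be factors of equal length.
\<close>

lemma first_digit_le_if_balanced:
  assumes V: "preperiodic_blocks a b V Y" and digits: "a \<ge> 1" "b \<ge> 0"
    and pre: "\<And>N. prefix (length (V N)) v = V N"
    and bal: "balanced_over 0 1 v"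
  shows "a \<le> b + 1"
proof (rule ccontr)
  assume "\<not> a \<le> b + 1"
  then have "list_power [0::nat] a = list_power [0] b @ list_power [0] (a - b)"
    using digits list_power_add[of b "a - b" "[0::nat]"] by simp
  also have "list_power [0::nat] (a - b) = [0, 0] @ list_power [0] (a - b - 2)"
    using \<open>\<not> a \<le> b + 1\<close> by (subst list_power_Cons; (subst list_power_Cons)?) (simp_all add: list_power_Cons)
  finally have z: "list_power [0::nat] a = list_power [0] b @ [0, 0] @ list_power [0] (a - b - 2)" .
  have V1: "V 1 = list_power [0] a @ [1]" and Y1: "Y 1 = list_power [0] b @ [1]"
    using V unfolding preperiodic_blocks_def by (simp_all add: One_nat_def)
  have X: "V 1 = [] @ (list_power [0] b @ [0, 0]) @ (list_power [0] (a - b - 2) @ [1])"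
    unfolding V1 z by simp
  have V2: "V 2 = list_power (V 1) a @ Y 1"
    using V unfolding preperiodic_blocks_def by (simp add: numeral_2_eq_2)
  have "list_power (V 1) a = list_power (V 1) (a - 1) @ list_power [0] a @ [1]"
    using list_power_snoc[OF digits(1), of "V 1"] V1 by simp
  with V2 have Y: "V 2 = (list_power (V 1) (a - 1) @ list_power [0] a) @ ([1] @ list_power [0] b @ [1]) @ []"
    unfolding Y1 by simp
  have "\<bar>int (count_list (list_power [0] b @ [0, 0]) (0::nat))
      - int (count_list ([1] @ list_power [0] b @ [1]) (0::nat))\<bar> \<le> 1"
    by (rule balanced_over_block_factors[where V = V, OF bal pre X Y]) simp
  then show False by simp
qed

lemma preperiodic_blocks_fixed:
  assumes V: "preperiodic_blocks (d + 1) d V Y"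
    and pre: "\<And>N. prefix (length (V N)) v = V N" and len: "\<And>N. N \<le> length (V N)"
  shows "fixed_by_subst (subst01 (list_power [0] (d + 1) @ [1]) (list_power [0] d @ [1])) v"
    (is "fixed_by_subst ?\<sigma> v")
proof (rule fixed_by_subst_if_prefixes[OF _ pre])
  show "?\<sigma> a \<noteq> []" for a by (simp add: subst01_def)
  show "\<exists>N. k \<le> length (V N)" for k using len by blast
  have "subst_list ?\<sigma> (V N) = V (N + 1) \<and> subst_list ?\<sigma> (Y N) = Y (N + 1)" for N
  proof (induction N)
    case 0
    then show ?case using V by (simp add: preperiodic_blocks_def)
  next
    case (Suc N)
    have eqs: "V (Suc N) = list_power (V N) (d + 1) @ Y N" "Y (Suc N) = list_power (V N) d @ Y N"
      "V (Suc (Suc N)) = list_power (V (Suc N)) (d + 1) @ Y (Suc N)"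
      "Y (Suc (Suc N)) = list_power (V (Suc N)) d @ Y (Suc N)"
      using V by (simp_all only: preperiodic_blocks_def)
    then show ?case
      using Suc by (simp add: subst_list_power)
  qed
  then show "subst_list ?\<sigma> (V N) = V (N + 1)" for N by blast
qed

section \<open>Quasi-greedy expansions of 1\<close>

lemma alternate_base_gt1: "alternate_base p \<beta> \<Longrightarrow> \<beta> n > 1"
  by (simp add: alternate_base_def)

lemma alternate_base_pos: "alternate_base p \<beta> \<Longrightarrow> \<beta> n > 0"
  using alternate_base_gt1[of p \<beta> n] by simp

lemma alternate_base_shift: "alternate_base p \<beta> \<Longrightarrow> alternate_base p (shift_base N \<beta>)"
  unfolding alternate_base_def shift_base_def
  by (metis (no_types, opaque_lifting) add.assoc add.commute)

lemma alternate_base_add_mult: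
  assumes "alternate_base p \<beta>"
  shows "\<beta> (n + int (k * p)) = \<beta> n"
proof (induction k)
  case (Suc k)
  have "\<beta> (n + int (Suc k * p)) = \<beta> (n + int (k * p) + int p)"
    by (simp add: algebra_simps)
  then show ?case
    using Suc assms by (simp add: alternate_base_def)
qed simp

lemma shift_base_period:
  assumes "alternate_base p \<beta>"
  shows "shift_base (int (i + k * p)) \<beta> = shift_base (int i) \<beta>"
proof
  fix n
  show "shift_base (int (i + k * p)) \<beta> n = shift_base (int i) \<beta> n"
    using alternate_base_add_mult[OF assms, of "n + int i" k] by (simp add: shift_base_def add_ac)
qed

lemma alternate_base_lower_bound:
  assumes "alternate_base p \<beta>"
  obtains b where "b > 1" "\<And>n. \<beta> n \<ge> b"
proof
  define b where "b = Min ((\<lambda>i. \<beta> (int i)) ` {..<p})"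
  have p: "p \<ge> 1" using assms by (simp add: alternate_base_def)
  have ne: "(\<lambda>i. \<beta> (int i)) ` {..<p} \<noteq> {}"
    using p by (auto simp: lessThan_empty_iff)
  show "b > 1"
    unfolding b_def using ne alternate_base_gt1[OF assms] by auto
  fix n :: int
  define q where "q = nat \<bar>n div int p\<bar>"
  define i where "i = nat (n mod int p)"
  have i: "int i = n mod int p" "i < p"
    using p by (auto simp: i_def nat_less_iff)
  have "\<beta> n = \<beta> (int i)"
  proof (cases "n div int p \<ge> 0")
    case True
    then have "n = int i + int (q * p)"
      using i by (simp add: q_def mult.commute)
    then show ?thesis using alternate_base_add_mult[OF assms] by metis
  next
    case False
    then have "int i = n + int (q * p)"
      using i minus_div_mult_eq_mod[of n "int p"] by (simp add: q_def)
    then show ?thesis using alternate_base_add_mult[OF assms] by metis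
  qed
  then show "\<beta> n \<ge> b"
    unfolding b_def using i(2) by (auto intro!: Min_le)
qed

text \<open>
  The quasi-greedy remainders of 1. They obey the rule of the greedy algorithm with the floor
  \<open>\<lfloor>y\<rfloor>\<close> replaced by \<open>\<lceil>y\<rceil> - 1\<close>, its limit from the left, and so stay in \<open>(0,1]\<close>.
\<close>

fun qg_remainder :: "(int \<Rightarrow> real) \<Rightarrow> nat \<Rightarrow> real" where
  "qg_remainder \<beta> 0 = 1"
| "qg_remainder \<beta> (Suc k) = \<beta> (- 1 - int k) * qg_remainder \<beta> k
     - of_int (\<lceil>\<beta> (- 1 - int k) * qg_remainder \<beta> k\<rceil> - 1)"

lemma qg_remainder_bounds: "0 < qg_remainder \<beta> k \<and> qg_remainder \<beta> k \<le> 1"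
  by (cases k; simp; linarith)

text \<open>
  One step of the greedy algorithm, for a remainder that tends to \<open>R\<close> from the left.
\<close>

lemma tendsto_left_floor_step:
  fixes f :: "real \<Rightarrow> real" and c :: real
  assumes f: "filterlim f (at_left R) F" and c: "c > 0"
  shows "eventually (\<lambda>x. \<lfloor>c * f x\<rfloor> = \<lceil>c * R\<rceil> - 1) F"
    and "filterlim (\<lambda>x. c * f x - of_int \<lfloor>c * f x\<rfloor>) (at_left (c * R - of_int (\<lceil>c * R\<rceil> - 1))) F"
proof -
  have lim: "(f \<longlongrightarrow> R) F" and lt: "eventually (\<lambda>x. f x < R) F"
    using f by (auto simp: filterlim_at elim: eventually_mono)
  have lim': "((\<lambda>x. c * f x) \<longlongrightarrow> c * R) F"
    using lim by (rule tendsto_mult_left)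
  have "of_int (\<lceil>c * R\<rceil> - 1) < c * R" by linarith
  from order_tendstoD(1)[OF lim' this] lt
  show fl: "eventually (\<lambda>x. \<lfloor>c * f x\<rfloor> = \<lceil>c * R\<rceil> - 1) F"
  proof eventually_elim
    case (elim x)
    then have "c * f x < c * R" using c by simp
    then show ?case using elim(1) by linarith
  qed
  have "((\<lambda>x. c * f x - of_int (\<lceil>c * R\<rceil> - 1)) \<longlongrightarrow> c * R - of_int (\<lceil>c * R\<rceil> - 1)) F"
    using lim' by (intro tendsto_diff tendsto_const)
  then have "((\<lambda>x. c * f x - of_int \<lfloor>c * f x\<rfloor>) \<longlongrightarrow> c * R - of_int (\<lceil>c * R\<rceil> - 1)) F"
    by (rule Lim_transform_eventually) (use fl in \<open>auto elim: eventually_mono\<close>)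
  moreover have "eventually (\<lambda>x. c * f x - of_int \<lfloor>c * f x\<rfloor> < c * R - of_int (\<lceil>c * R\<rceil> - 1)) F"
    using fl lt by eventually_elim (use c in simp)
  ultimately show "filterlim (\<lambda>x. c * f x - of_int \<lfloor>c * f x\<rfloor>)
      (at_left (c * R - of_int (\<lceil>c * R\<rceil> - 1))) F"
    by (auto simp: filterlim_at elim: eventually_mono)
qed

lemma remainder_tendsto_qg_remainder:
  assumes "alternate_base p \<beta>"
  shows "filterlim (\<lambda>x. remainder \<beta> (-1) x k) (at_left (qg_remainder \<beta> k)) (at_left 1)"
proof (induction k)
  case 0
  then show ?case by (simp add: filterlim_ident)
next
  case (Suc k)
  then show ?case
    using tendsto_left_floor_step(2)[OF Suc alternate_base_pos[OF assms, of "- 1 - int k"]] by simp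
qed

lemma expansion_below_1:
  assumes "x < 1" "n < 0"
  shows "expansion \<beta> x n = \<lfloor>\<beta> n * remainder \<beta> (-1) x (nat (- 1 - n))\<rfloor>"
  using assms by (simp add: expansion_def top_index_def Let_def)

lemma left_limit_expansion_eq:
  assumes "alternate_base p \<beta>"
  shows "left_limit_expansion \<beta> n =
    (if n \<ge> 0 then 0 else \<lceil>\<beta> n * qg_remainder \<beta> (nat (- 1 - n))\<rceil> - 1)"
proof -
  define a where "a = (\<lambda>n::int. if n \<ge> 0 then 0
    else \<lceil>\<beta> n * qg_remainder \<beta> (nat (- 1 - n))\<rceil> - 1)"
  have below1: "eventually (\<lambda>x::real. x < 1) (at_left 1)"
    by (simp add: eventually_at_filter)
  have coord: "((\<lambda>x. expansion \<beta> x n) \<longlongrightarrow> a n) (at_left 1)" for n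
  proof (rule tendsto_eventually, cases "n \<ge> 0")
    case True
    show "eventually (\<lambda>x. expansion \<beta> x n = a n) (at_left 1)"
      using below1 by eventually_elim (use True in \<open>simp add: expansion_def top_index_def a_def\<close>)
  next
    case False
    show "eventually (\<lambda>x. expansion \<beta> x n = a n) (at_left 1)"
      using below1 tendsto_left_floor_step(1)[OF remainder_tendsto_qg_remainder[OF assms]
          alternate_base_pos[OF assms, of n], of "nat (- 1 - n)"]
    proof eventually_elim
      case (elim x)
      then show ?case using False expansion_below_1[of x n \<beta>] by (simp add: a_def)
    qed
  qed
  have lim: "(expansion \<beta> \<longlongrightarrow> a) (at_left 1)"
  proof -
    have "limitin (product_topology (\<lambda>i. euclidean) UNIV) (expansion \<beta>) a (at_left 1)"
      using coord by (simp add: limitin_componentwise)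
    then show ?thesis
      by (simp add: euclidean_product_topology)
  qed
  \<comment> \<open>limits in the product topology are unique, since they are taken coordinatewise\<close>
  have "left_limit_expansion \<beta> = a"
    unfolding left_limit_expansion_def
  proof (rule the_equality, rule lim)
    fix a' assume "(expansion \<beta> \<longlongrightarrow> a') (at_left 1)"
    then have "limitin (product_topology (\<lambda>i. euclidean) UNIV) (expansion \<beta>) a' (at_left 1)"
      by (simp add: euclidean_product_topology)
    then have "((\<lambda>x. expansion \<beta> x n) \<longlongrightarrow> a' n) (at_left 1)" for n
      by (simp add: limitin_componentwise)
    then show "a' = a"
      using coord tendsto_unique[OF trivial_limit_at_left_real] by blast
  qed
  then show ?thesis by (simp add: a_def)
qed

lemma quasi_greedy_eq:
  assumes "alternate_base p \<beta>"
  shows "quasi_greedy \<beta> k = \<lceil>\<beta> (- 1 - int k) * qg_remainder \<beta> k\<rceil> - 1"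
  by (simp add: quasi_greedy_def left_limit_expansion_eq[OF assms])

lemma qg_remainder_Suc:
  assumes "alternate_base p \<beta>"
  shows "qg_remainder \<beta> (Suc k) = \<beta> (- 1 - int k) * qg_remainder \<beta> k - of_int (quasi_greedy \<beta> k)"
  by (simp add: quasi_greedy_eq[OF assms])

lemma quasi_greedy_nonneg:
  assumes "alternate_base p \<beta>"
  shows "quasi_greedy \<beta> k \<ge> 0"
proof -
  have "\<beta> (- 1 - int k) * qg_remainder \<beta> k > 0"
    using alternate_base_pos[OF assms] qg_remainder_bounds[of \<beta> k] by simp
  then show ?thesis
    by (simp add: quasi_greedy_eq[OF assms])
qed

lemma quasi_greedy_first_ge_1:
  assumes "alternate_base p \<beta>"
  shows "quasi_greedy \<beta> 0 \<ge> 1"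
  using alternate_base_gt1[OF assms, of "-1"] by (simp add: quasi_greedy_eq[OF assms])

text \<open>
  A quasi-greedy remainder is determined by the bases and the digits that follow it: each step of
  the algorithm multiplies the distance of two remainders by a base, while all remainders lie
  in \<open>(0,1]\<close>.
\<close>

lemma qg_remainder_eq_if_digits_eq:
  assumes ab: "alternate_base p \<beta>"
    and base: "\<And>j. \<beta> (- 1 - int (k + j)) = \<beta> (- 1 - int (i + j))"
    and digits: "\<And>j. quasi_greedy \<beta> (k + j) = quasi_greedy \<beta> (i + j)"
  shows "qg_remainder \<beta> k = qg_remainder \<beta> i"
proof (rule ccontr)
  assume neq: "qg_remainder \<beta> k \<noteq> qg_remainder \<beta> i"
  define D where "D j = \<bar>qg_remainder \<beta> (k + j) - qg_remainder \<beta> (i + j)\<bar>" for j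
  obtain b where b: "b > 1" "\<And>n. \<beta> n \<ge> b"
    using alternate_base_lower_bound[OF ab] by metis
  have step: "D (Suc j) \<ge> b * D j" for j
  proof -
    have "qg_remainder \<beta> (k + Suc j) - qg_remainder \<beta> (i + Suc j)
        = \<beta> (- 1 - int (i + j)) * (qg_remainder \<beta> (k + j) - qg_remainder \<beta> (i + j))"
      unfolding add_Suc_right qg_remainder_Suc[OF ab] digits base by (simp add: algebra_simps)
    then have "D (Suc j) = \<beta> (- 1 - int (i + j)) * D j"
      using alternate_base_pos[OF ab, of "- 1 - int (i + j)"] by (simp add: D_def abs_mult)
    then show ?thesis
      using b(2) by (simp add: D_def mult_right_mono)
  qed
  have grow: "D j \<ge> b ^ j * D 0" for j
  proof (induction j)
    case (Suc j)
    have "b ^ Suc j * D 0 \<le> b * D j" using Suc b(1) by simp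
    then show ?case using step[of j] by linarith
  qed simp
  have D0: "D 0 > 0" using neq by (simp add: D_def)
  obtain j where "1 / D 0 < b ^ j" using real_arch_pow[OF b(1)] by metis
  then have "D j > 1" using grow[of j] D0 by (simp add: field_simps)
  moreover have "D j < 1"
    using qg_remainder_bounds[of \<beta> "k + j"] qg_remainder_bounds[of \<beta> "i + j"]
    unfolding D_def by linarith
  ultimately show False by simp
qed

section \<open>Integers of an alternate base\<close>

text \<open>
  The place values \<open>P\<^sub>N = \<beta>\<^bsub>N-1\<^esub> \<cdots> \<beta>\<^sub>0\<close>: the integer with the digit 1 at the index \<open>N\<close> and zeros elsewhere.
\<close>

definition base_prod :: "(int \<Rightarrow> real) \<Rightarrow> nat \<Rightarrow> real" where
  "base_prod \<beta> N = (\<Prod>i<N. \<beta> (int i))"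

lemma base_prod_0 [simp]: "base_prod \<beta> 0 = 1"
  by (simp add: base_prod_def)

lemma base_prod_Suc: "base_prod \<beta> (Suc N) = \<beta> (int N) * base_prod \<beta> N"
  by (simp add: base_prod_def)

lemma prod_int_interval: "(\<Prod>i\<in>{0..int N}. \<beta> i) = base_prod \<beta> (Suc N)"
proof -
  have "(\<Prod>i\<in>{0..int N}. \<beta> i) = (\<Prod>i\<in>int ` {..N}. \<beta> i)"
    by (simp add: image_int_atLeastAtMost flip: atLeast0AtMost)
  also have "\<dots> = base_prod \<beta> (Suc N)"
    by (simp add: prod.reindex base_prod_def lessThan_Suc_atMost)
  finally show ?thesis .
qed

text \<open>The digits of \<open>y\<close> when the greedy algorithm is started at the index \<open>K - 1\<close>.\<close>

definition level_digit :: "(int \<Rightarrow> real) \<Rightarrow> nat \<Rightarrow> real \<Rightarrow> int \<Rightarrow> int" where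
  "level_digit \<beta> K y n =
    \<lfloor>\<beta> n * remainder \<beta> (int K - 1) (y / base_prod \<beta> K) (nat (int K - 1 - n))\<rfloor>"

text \<open>The \<open>B\<close>-integers smaller than \<open>y\<close>, and their number.\<close>

definition integers_below :: "(int \<Rightarrow> real) \<Rightarrow> real \<Rightarrow> real set" where
  "integers_below \<beta> y = {b \<in> B_integers \<beta>. b < y}"

definition num_below :: "(int \<Rightarrow> real) \<Rightarrow> real \<Rightarrow> nat" where
  "num_below \<beta> y = card (integers_below \<beta> y)"

text \<open>
  The letter that stands for the index \<open>n\<close> in \<open>v\<^sub>B\<close>, and the prefix of \<open>v\<^sub>B\<close> that corresponds to
  the integers below \<open>P\<^sub>N\<close>.
\<close>

definition index_letter :: "nat \<Rightarrow> (int \<Rightarrow> real) \<Rightarrow> nat \<Rightarrow> nat" where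
  "index_letter p \<beta> n = (let l = preperiod_par p \<beta>; m = period_par p \<beta>
    in if n < l * p then n else l * p + (n - l * p) mod (m * p))"

definition v_block :: "nat \<Rightarrow> (int \<Rightarrow> real) \<Rightarrow> nat \<Rightarrow> nat list" where
  "v_block p \<beta> N = prefix (num_below \<beta> (base_prod \<beta> N)) (v_word p \<beta>)"

context
  fixes p :: nat and \<beta> :: "int \<Rightarrow> real"
  assumes ab: "alternate_base p \<beta>"
begin

private abbreviation (input) P where "P \<equiv> base_prod \<beta>"

lemma base_prod_pos: "P N > 0"
  unfolding base_prod_def by (intro prod_pos) (simp add: alternate_base_pos[OF ab])

lemma base_prod_less_Suc: "P N < P (Suc N)"
  using base_prod_pos[of N] alternate_base_gt1[OF ab, of "int N"] by (simp add: base_prod_Suc)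

lemma strict_mono_base_prod: "strict_mono P"
  by (simp add: strict_mono_Suc_iff base_prod_less_Suc)

lemma base_prod_le_iff: "P M \<le> P N \<longleftrightarrow> M \<le> N"
  by (simp add: strict_mono_less_eq[OF strict_mono_base_prod])

lemma base_prod_ge_1: "P N \<ge> 1"
  using base_prod_le_iff[of 0 N] by simp

lemma base_prod_unbounded: "\<exists>N. y < P N"
proof -
  obtain b where b: "b > 1" "\<And>n. \<beta> n \<ge> b"
    using alternate_base_lower_bound[OF ab] by metis
  have "b ^ N \<le> P N" for N
  proof (induction N)
    case (Suc N)
    then show ?case
      using b(1) b(2)[of "int N"] by (auto simp: base_prod_Suc intro: mult_mono)
  qed simp
  moreover obtain N where "y < b ^ N" using real_arch_pow[OF b(1)] by metis
  ultimately show ?thesis by (meson less_le_trans)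
qed

lemma top_index_below_1: "y < 1 \<Longrightarrow> top_index \<beta> y = -1"
  by (simp add: top_index_def)

lemma top_index_eq:
  assumes "P N \<le> y" "y < P (Suc N)"
  shows "top_index \<beta> y = int N"
proof -
  have "(LEAST M. y < P (Suc M)) = N"
  proof (rule Least_equality)
    fix M assume "y < P (Suc M)"
    then have "P N < P (Suc M)" using assms(1) by linarith
    then show "N \<le> M" using base_prod_le_iff[of "Suc M" N] by linarith
  qed (rule assms(2))
  moreover have "\<not> y < 1" using assms(1) base_prod_ge_1[of N] by linarith
  ultimately show ?thesis by (simp add: top_index_def prod_int_interval)
qed

lemma expansion_zero_above:
  assumes "y < P K" "n \<ge> int K"
  shows "expansion \<beta> y n = 0"
proof -
  have "top_index \<beta> y < int K"
  proof (cases "y < 1")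
    case True
    then show ?thesis by (simp add: top_index_below_1)
  next
    case False
    then obtain M where M: "K = Suc M" using assms(1) by (cases K) auto
    have "(LEAST N. y < P (Suc N)) \<le> M"
      by (rule Least_le) (use assms(1) M in simp)
    then show ?thesis using False M by (simp add: top_index_def prod_int_interval)
  qed
  then show ?thesis using assms(2) by (simp add: expansion_def Let_def)
qed

lemma remainder_Suc_shift:
  "remainder \<beta> N r (Suc k) = remainder \<beta> (N - 1) (remainder \<beta> N r 1) k"
proof (induction k)
  case (Suc k)
  have "N - int (Suc k) = N - 1 - int k" by simp
  then show ?case
    using Suc by (simp only: remainder.simps(2)[of \<beta> N r "Suc k"] remainder.simps(2)[of \<beta> "N - 1" _ k])
qed simp

lemma level_digit_top: "level_digit \<beta> (Suc K) y (int K) = \<lfloor>y / P K\<rfloor>"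
  using alternate_base_pos[OF ab, of "int K"] by (simp add: level_digit_def base_prod_Suc)

lemma level_digit_Suc:
  assumes "n < int K"
  shows "level_digit \<beta> (Suc K) y n = level_digit \<beta> K (y - of_int \<lfloor>y / P K\<rfloor> * P K) n"
proof -
  have bp: "\<beta> (int K) > 0" "P K > 0"
    using alternate_base_pos[OF ab] base_prod_pos by auto
  have "nat (int (Suc K) - 1 - n) = Suc (nat (int K - 1 - n))"
    using assms by simp
  moreover have "remainder \<beta> (int (Suc K) - 1) (y / P (Suc K)) 1
      = (y - of_int \<lfloor>y / P K\<rfloor> * P K) / P K"
    using bp by (simp add: base_prod_Suc diff_divide_distrib)
  ultimately show ?thesis
    by (simp only: level_digit_def remainder_Suc_shift) simp
qed

text \<open>
  Starting the greedy algorithm at a higher index than needed only adds leading zeros.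
\<close>

lemma expansion_eq_level_digit:
  assumes "0 \<le> y" "y < P K" "n < int K"
  shows "expansion \<beta> y n = level_digit \<beta> K y n"
  using assms
proof (induction K arbitrary: n)
  case 0
  then show ?case by (simp add: expansion_def top_index_below_1 level_digit_def Let_def)
next
  case (Suc K)
  show ?case
  proof (cases "P K \<le> y")
    case True
    then show ?thesis
      using top_index_eq[OF True Suc.prems(2)] Suc.prems(3)
      by (simp add: expansion_def Let_def prod_int_interval level_digit_def)
  next
    case False
    then have fl: "\<lfloor>y / P K\<rfloor> = 0"
      using Suc.prems(1) base_prod_pos[of K] by (simp add: floor_eq_iff)
    show ?thesis
    proof (cases "n = int K")
      case True
      then show ?thesis
        using fl expansion_zero_above[of y K n] False by (simp add: level_digit_top)
    next
      case neq: False
      then have "n < int K" using Suc.prems(3) by simp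
      then show ?thesis
        using Suc.IH[of n] Suc.prems(1) False fl by (simp add: level_digit_Suc)
    qed
  qed
qed

text \<open>
  The expansion of \<open>a P\<^sub>K + y\<close> with \<open>y < P\<^sub>K\<close> is that of \<open>y\<close> with the digit \<open>a\<close> put at the index
  \<open>K\<close>, as long as the number stays below \<open>P\<^bsub>K+1\<^esub>\<close>.
\<close>

lemma expansion_add:
  assumes "0 \<le> y" "y < P K" "real a * P K + y < P (Suc K)"
  shows expansion_add_top: "expansion \<beta> (real a * P K + y) (int K) = int a"
    and expansion_add_below: "n < int K \<Longrightarrow> expansion \<beta> (real a * P K + y) n = expansion \<beta> y n"
proof -
  have pos: "P K > 0" by (rule base_prod_pos)
  have "(real a * P K + y) / P K = real a + y / P K"
    using pos by (simp add: add_divide_distrib)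
  moreover have "0 \<le> y / P K" "y / P K < 1"
    using assms(1,2) pos by auto
  ultimately have fl: "\<lfloor>(real a * P K + y) / P K\<rfloor> = int a"
    by (simp add: floor_eq_iff)
  have nn: "0 \<le> real a * P K + y" using assms(1) pos by simp
  show "expansion \<beta> (real a * P K + y) (int K) = int a"
    by (subst expansion_eq_level_digit[OF nn assms(3)]) (simp_all add: level_digit_top fl)
  show "expansion \<beta> (real a * P K + y) n = expansion \<beta> y n" if "n < int K"
    using that expansion_eq_level_digit[OF nn assms(3), of n]
      expansion_eq_level_digit[OF assms(1,2) that] level_digit_Suc[OF that, of "real a * P K + y"] fl
    by simp
qed

lemma B_integers_nonneg: "y \<in> B_integers \<beta> \<Longrightarrow> 0 \<le> y"
  by (simp add: B_integers_def)

text \<open>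
  A nonzero remainder whose digits all vanish would grow beyond 1, so 0 is the only integer below 1.
\<close>

lemma B_integer_less_1:
  assumes "y < 1"
  shows "y \<in> B_integers \<beta> \<longleftrightarrow> y = 0"
proof
  assume "y = 0"
  moreover have "remainder \<beta> (-1) 0 k = 0" for k
    by (induction k) auto
  ultimately show "y \<in> B_integers \<beta>"
    by (simp add: B_integers_def expansion_below_1)
next
  assume y: "y \<in> B_integers \<beta>"
  obtain b where b: "b > 1" "\<And>n. \<beta> n \<ge> b"
    using alternate_base_lower_bound[OF ab] by metis
  have digit: "\<lfloor>\<beta> (- 1 - int k) * remainder \<beta> (-1) y k\<rfloor> = 0" for k
    using y assms expansion_below_1[of y "- 1 - int k" \<beta>] by (simp add: B_integers_def)
  have grow: "remainder \<beta> (-1) y k \<ge> b ^ k * y" for k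
  proof (induction k)
    case (Suc k)
    have "0 \<le> b ^ k * y"
      using b(1) B_integers_nonneg[OF y] by simp
    then have "b * (b ^ k * y) \<le> \<beta> (- 1 - int k) * remainder \<beta> (-1) y k"
      using Suc b(2)[of "- 1 - int k"] b(1) by (intro mult_mono) auto
    then show ?case using digit[of k] by simp
  qed simp
  have "remainder \<beta> (-1) y k < 1" for k
  proof (cases k)
    case (Suc j)
    then show ?thesis by simp linarith
  qed (use assms in simp)
  then have less: "b ^ k * y < 1" for k
    using grow[of k] by (meson le_less_trans)
  show "y = 0"
  proof (rule ccontr)
    assume "y \<noteq> 0"
    then have "y > 0" using B_integers_nonneg[OF y] by simp
    moreover obtain k where "1 / y < b ^ k" using real_arch_pow[OF b(1)] by metis
    ultimately show False using less[of k] by (simp add: field_simps)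
  qed
qed

lemma B_integer_add_iff:
  assumes "0 \<le> y" "y < P K" "real a * P K + y < P (Suc K)"
  shows "real a * P K + y \<in> B_integers \<beta> \<longleftrightarrow> y \<in> B_integers \<beta>"
  using assms expansion_add_below[OF assms] base_prod_pos[of K]
  by (auto simp: B_integers_def)

subsection \<open>Counting the integers below a bound\<close>

text \<open>
  Above a multiple of \<open>P\<^sub>K\<close> the integers repeat those from 0 to \<open>P\<^sub>K\<close>, as long as they stay below
  \<open>P\<^bsub>K+1\<^esub>\<close>.
\<close>

lemma integers_below_add:
  assumes "0 \<le> y" "y \<le> P K" "real a * P K + y \<le> P (Suc K)"
  shows "integers_below \<beta> (real a * P K + y) = integers_below \<beta> (real a * P K) \<union> (+) (real a * P K) ` integers_below \<beta> y"
proof (intro equalityI subsetI)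
  fix b assume b: "b \<in> integers_below \<beta> (real a * P K + y)"
  show "b \<in> integers_below \<beta> (real a * P K) \<union> (+) (real a * P K) ` integers_below \<beta> y"
  proof (cases "b < real a * P K")
    case True
    then show ?thesis using b by (simp add: integers_below_def)
  next
    case False
    define z where "z = b - real a * P K"
    have "b = real a * P K + z" by (simp add: z_def)
    moreover have "z \<in> integers_below \<beta> y"
      using False b assms B_integer_add_iff[of z K a] by (auto simp: integers_below_def z_def)
    ultimately show ?thesis by blast
  qed
next
  fix b assume "b \<in> integers_below \<beta> (real a * P K) \<union> (+) (real a * P K) ` integers_below \<beta> y"
  then consider "b \<in> integers_below \<beta> (real a * P K)" | z where "b = real a * P K + z" "z \<in> integers_below \<beta> y"
    by blast
  then show "b \<in> integers_below \<beta> (real a * P K + y)"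
  proof cases
    case 1
    then show ?thesis using assms(1) by (auto simp: integers_below_def)
  next
    case 2
    then show ?thesis
      using assms B_integer_add_iff[of z K a] B_integers_nonneg[of z] by (auto simp: integers_below_def)
  qed
qed

lemma integers_below_add_disjoint: "integers_below \<beta> (real a * P K) \<inter> (+) (real a * P K) ` integers_below \<beta> y = {}"
  by (auto simp: integers_below_def dest: B_integers_nonneg)

lemma integers_below_mult:
  assumes "finite (integers_below \<beta> (P K))" "real a * P K \<le> P (Suc K)"
  shows "finite (integers_below \<beta> (real a * P K)) \<and> num_below \<beta> (real a * P K) = a * num_below \<beta> (P K)"
  using assms(2)
proof (induction a)
  case 0
  have "integers_below \<beta> 0 = {}" by (auto simp: integers_below_def dest: B_integers_nonneg)
  then show ?case by (simp add: num_below_def)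
next
  case (Suc a)
  have eq: "real (Suc a) * P K = real a * P K + P K" by (simp add: algebra_simps)
  have pos: "P K > 0" by (rule base_prod_pos)
  have le: "real a * P K \<le> P (Suc K)" using Suc.prems pos unfolding eq by linarith
  have dec: "integers_below \<beta> (real (Suc a) * P K) = integers_below \<beta> (real a * P K) \<union> (+) (real a * P K) ` integers_below \<beta> (P K)"
    unfolding eq by (rule integers_below_add) (use Suc.prems pos eq in auto)
  have "num_below \<beta> (real (Suc a) * P K) = num_below \<beta> (real a * P K) + card ((+) (real a * P K) ` integers_below \<beta> (P K))"
    unfolding num_below_def dec
    by (rule card_Un_disjoint) (use Suc.IH le assms(1) integers_below_add_disjoint in auto)
  moreover have "card ((+) (real a * P K) ` integers_below \<beta> (P K)) = num_below \<beta> (P K)"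
    by (simp add: card_image num_below_def)
  ultimately show ?case
    using Suc.IH[OF le] dec assms(1) by simp
qed

lemma finite_integers_below_base_prod: "finite (integers_below \<beta> (P K))"
proof (induction K)
  case 0
  have "integers_below \<beta> (P 0) \<subseteq> {0}" by (auto simp: integers_below_def B_integer_less_1)
  then show ?case using finite_subset by blast
next
  case (Suc K)
  have pos: "P K > 0" by (rule base_prod_pos)
  define a where "a = nat \<lfloor>P (Suc K) / P K\<rfloor>"
  define y where "y = P (Suc K) - real a * P K"
  have "P (Suc K) / P K > 0" using base_prod_pos by simp
  then have a: "real a = of_int \<lfloor>P (Suc K) / P K\<rfloor>" by (simp add: a_def)
  have "real a \<le> P (Suc K) / P K" "P (Suc K) / P K < real a + 1" unfolding a by linarith+
  then have y: "0 \<le> y" "y \<le> P K"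
    using pos by (simp_all add: y_def field_simps)
  have eq: "P (Suc K) = real a * P K + y" by (simp add: y_def)
  have "integers_below \<beta> (P (Suc K)) = integers_below \<beta> (real a * P K) \<union> (+) (real a * P K) ` integers_below \<beta> y"
    using integers_below_add[OF y, of a] eq by simp
  moreover have "finite (integers_below \<beta> (real a * P K))"
    using integers_below_mult[OF Suc] y eq by simp
  moreover have "finite (integers_below \<beta> y)"
    by (rule finite_subset[OF _ Suc]) (use y in \<open>auto simp: integers_below_def\<close>)
  ultimately show ?case by simp
qed

lemma finite_integers_below: "finite (integers_below \<beta> y)"
proof -
  obtain K where "y < P K" using base_prod_unbounded by blast
  then have "integers_below \<beta> y \<subseteq> integers_below \<beta> (P K)" by (auto simp: integers_below_def)
  then show ?thesis using finite_integers_below_base_prod finite_subset by blast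
qed

lemma num_below_add:
  assumes "0 \<le> y" "y \<le> P K" "real a * P K + y \<le> P (Suc K)"
  shows "num_below \<beta> (real a * P K + y) = a * num_below \<beta> (P K) + num_below \<beta> y"
proof -
  have "num_below \<beta> (real a * P K + y) = num_below \<beta> (real a * P K) + card ((+) (real a * P K) ` integers_below \<beta> y)"
    unfolding num_below_def integers_below_add[OF assms]
    by (rule card_Un_disjoint) (use finite_integers_below integers_below_add_disjoint in auto)
  moreover have "card ((+) (real a * P K) ` integers_below \<beta> y) = num_below \<beta> y"
    by (simp add: card_image num_below_def)
  ultimately show ?thesis
    using integers_below_mult[OF finite_integers_below_base_prod, of a K] assms by simp
qed

lemma num_below_mono: "y \<le> z \<Longrightarrow> num_below \<beta> y \<le> num_below \<beta> z"
  unfolding num_below_def by (rule card_mono[OF finite_integers_below]) (auto simp: integers_below_def)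

lemma num_below_strict_mono:
  assumes "y \<in> B_integers \<beta>" "y < z"
  shows "num_below \<beta> y < num_below \<beta> z"
  unfolding num_below_def by (rule psubset_card_mono[OF finite_integers_below]) (use assms in \<open>auto simp: integers_below_def\<close>)

lemma num_below_0 [simp]: "num_below \<beta> 0 = 0"
proof -
  have "integers_below \<beta> 0 = {}" by (auto simp: integers_below_def dest: B_integers_nonneg)
  then show ?thesis by (simp add: num_below_def)
qed

lemma zero_B_integer: "0 \<in> B_integers \<beta>"
  by (simp add: B_integer_less_1)

lemma num_below_unit:
  assumes "0 < y" "y \<le> 1"
  shows "num_below \<beta> y = 1"
proof -
  have "integers_below \<beta> y = {0}"
    using assms zero_B_integer by (auto simp: integers_below_def B_integer_less_1)
  then show ?thesis by (simp add: num_below_def)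
qed

lemma base_prod_B_integer: "P K \<in> B_integers \<beta>"
  using B_integer_add_iff[of 0 K 1] zero_B_integer base_prod_pos[of K] base_prod_less_Suc[of K] by simp

subsection \<open>The increasing enumeration\<close>

private abbreviation (input) cnt where "cnt N \<equiv> num_below \<beta> (P N)"

lemma num_below_1 [simp]: "num_below \<beta> 1 = 1"
  by (simp add: num_below_unit)

lemma cnt_less_Suc: "cnt N < cnt (Suc N)"
  by (rule num_below_strict_mono[OF base_prod_B_integer base_prod_less_Suc])

lemma strict_mono_cnt: "strict_mono cnt"
  by (simp add: strict_mono_Suc_iff cnt_less_Suc)

lemma cnt_pos: "cnt N > 0"
  using strict_mono_less_eq[OF strict_mono_cnt, of 0 N] num_below_1 by simp

lemma less_cnt: "n < cnt n"
proof (induction n)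
  case (Suc n)
  then show ?case using cnt_less_Suc[of n] by simp
qed simp

lemma inj_num_below: "inj_on (num_below \<beta>) (B_integers \<beta>)"
  by (rule linorder_inj_onI') (use num_below_strict_mono in \<open>metis less_irrefl\<close>)

lemma num_below_surj: "num_below \<beta> ` B_integers \<beta> = UNIV"
proof -
  have "\<exists>b\<in>B_integers \<beta>. num_below \<beta> b = n" for n
  proof (induction n)
    case 0
    then show ?case using zero_B_integer num_below_0 by blast
  next
    case (Suc n)
    then obtain b where b: "b \<in> B_integers \<beta>" "num_below \<beta> b = n" by blast
    obtain K where K: "b < P K" using base_prod_unbounded by blast
    define S where "S = {z \<in> B_integers \<beta>. b < z \<and> z \<le> P K}"
    have "S \<subseteq> insert (P K) (integers_below \<beta> (P K))" by (auto simp: S_def integers_below_def)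
    then have fin: "finite S" using finite_integers_below finite_subset by blast
    have ne: "S \<noteq> {}" using K base_prod_B_integer by (auto simp: S_def)
    define c where "c = Min S"
    have c: "c \<in> S" unfolding c_def using fin ne by simp
    have min: "z \<ge> c" if "z \<in> S" for z unfolding c_def using fin that by simp
    have "integers_below \<beta> c = insert b (integers_below \<beta> b)"
    proof (intro equalityI subsetI)
      fix z assume z: "z \<in> integers_below \<beta> c"
      show "z \<in> insert b (integers_below \<beta> b)"
      proof (rule ccontr)
        assume "z \<notin> insert b (integers_below \<beta> b)"
        then have "z \<in> S" using z c by (auto simp: integers_below_def S_def)
        then show False using min[of z] z by (auto simp: integers_below_def)
      qed
    next
      fix z assume "z \<in> insert b (integers_below \<beta> b)"
      then show "z \<in> integers_below \<beta> c" using b c by (auto simp: integers_below_def S_def)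
    qed
    moreover have "b \<notin> integers_below \<beta> b" by (simp add: integers_below_def)
    ultimately have "num_below \<beta> c = Suc n" using b(2) finite_integers_below by (simp add: num_below_def)
    then show ?case using c by (auto simp: S_def)
  qed
  then show ?thesis by (metis (mono_tags, lifting) UNIV_eq_I image_eqI)
qed

private abbreviation (input) xs where "xs \<equiv> B_integer_enum \<beta>"

lemma enum_eq: "xs = inv_into (B_integers \<beta>) (num_below \<beta>)"
proof -
  let ?x = "inv_into (B_integers \<beta>) (num_below \<beta>)"
  have mem: "?x n \<in> B_integers \<beta>" and cx: "num_below \<beta> (?x n) = n" for n
    using num_below_surj by (simp_all add: inv_into_into f_inv_into_f)
  have xc: "?x (num_below \<beta> b) = b" if "b \<in> B_integers \<beta>" for b
    using inj_num_below that by simp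
  have mono: "strict_mono ?x"
  proof (rule strict_monoI, rule ccontr)
    fix m n :: nat assume mn: "m < n" "\<not> ?x m < ?x n"
    then have "num_below \<beta> (?x n) \<le> num_below \<beta> (?x m)" by (intro num_below_mono) simp
    then show False using mn cx by simp
  qed
  have range: "range ?x = B_integers \<beta>"
    using mem xc by (metis image_subset_iff range_eqI subsetI subset_antisym)
  show ?thesis
    unfolding B_integer_enum_def
  proof (rule the_equality)
    show "strict_mono ?x \<and> range ?x = B_integers \<beta>" using mono range by blast
    fix x :: "nat \<Rightarrow> real" assume x: "strict_mono x \<and> range x = B_integers \<beta>"
    have "num_below \<beta> (x n) = n" for n
    proof -
      have "integers_below \<beta> (x n) = x ` {m. x m < x n}"
        using x by (auto simp: integers_below_def)
      also have "{m. x m < x n} = {..<n}"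
        using x by (auto simp: strict_mono_less)
      finally have "integers_below \<beta> (x n) = x ` {..<n}" .
      moreover have "inj_on x {..<n}"
        using x strict_mono_imp_inj_on by blast
      ultimately show ?thesis by (simp add: num_below_def card_image)
    qed
    then show "x = ?x" using x xc by (metis ext rangeI)
  qed
qed

lemma enum_B_integer: "xs n \<in> B_integers \<beta>"
  and num_below_enum: "num_below \<beta> (xs n) = n"
  and enum_num_below: "b \<in> B_integers \<beta> \<Longrightarrow> xs (num_below \<beta> b) = b"
  using num_below_surj inj_num_below unfolding enum_eq by (simp_all add: inv_into_into f_inv_into_f)

lemma enum_less_iff: "xs n < y \<longleftrightarrow> n < num_below \<beta> y"
  using num_below_strict_mono[OF enum_B_integer, of n y] num_below_mono[of y "xs n"]
  by (simp add: num_below_enum) linarith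

text \<open>
  The digits of the \<open>k\<close>-th integer are those of the greedy representation of \<open>k\<close> in the numeration
  system \<open>c\<^sub>0, c\<^sub>1, \<dots>\<close>, where \<open>c\<^sub>N\<close> is the number of integers below \<open>P\<^sub>N\<close>.
\<close>

lemma enum_decomp:
  assumes "k < cnt (Suc N)"
  shows "xs k = real (k div cnt N) * P N + xs (k mod cnt N)"
proof -
  have pos: "P N > 0" by (rule base_prod_pos)
  define a where "a = nat \<lfloor>xs k / P N\<rfloor>"
  define y where "y = xs k - real a * P N"
  have nn: "xs k \<ge> 0" by (rule B_integers_nonneg[OF enum_B_integer])
  then have "real a = of_int \<lfloor>xs k / P N\<rfloor>" using pos by (simp add: a_def)
  then have "real a \<le> xs k / P N" "xs k / P N < real a + 1" by linarith+
  then have y: "0 \<le> y" "y < P N" using pos by (simp_all add: y_def field_simps)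
  have eq: "xs k = real a * P N + y" by (simp add: y_def)
  have less: "xs k < P (Suc N)" using assms by (simp add: enum_less_iff)
  have yB: "y \<in> B_integers \<beta>"
    using B_integer_add_iff[OF y, of a] less enum_B_integer[of k] eq by simp
  have "k = a * cnt N + num_below \<beta> y"
    using num_below_add[of y N a] y less eq num_below_enum[of k] by simp
  moreover have "num_below \<beta> y < cnt N" by (rule num_below_strict_mono[OF yB y(2)])
  ultimately have "k div cnt N = a" "k mod cnt N = num_below \<beta> y" by auto
  then show ?thesis using eq enum_num_below[OF yB] by simp
qed

lemma expansion_enum_above:
  assumes "k < cnt N" "n \<ge> N"
  shows "expansion \<beta> (xs k) (int n) = 0"
  by (rule expansion_zero_above[of _ N]) (use assms in \<open>simp_all add: enum_less_iff\<close>)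

lemma expansion_enum:
  assumes "k < cnt (Suc N)"
  shows expansion_enum_top: "expansion \<beta> (xs k) (int N) = int (k div cnt N)"
    and expansion_enum_below: "n < N \<Longrightarrow> expansion \<beta> (xs k) (int n) = expansion \<beta> (xs (k mod cnt N)) (int n)"
proof -
  have less: "xs (k mod cnt N) < P N" using cnt_pos[of N] by (simp add: enum_less_iff)
  have nn: "xs (k mod cnt N) \<ge> 0" by (rule B_integers_nonneg[OF enum_B_integer])
  have "xs k < P (Suc N)" using assms by (simp add: enum_less_iff)
  then have lt: "real (k div cnt N) * P N + xs (k mod cnt N) < P (Suc N)"
    using enum_decomp[OF assms] by simp
  show "expansion \<beta> (xs k) (int N) = int (k div cnt N)"
    using expansion_add_top[OF nn less lt] enum_decomp[OF assms] by simp
  show "expansion \<beta> (xs k) (int n) = expansion \<beta> (xs (k mod cnt N)) (int n)" if "n < N"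
    using expansion_add_below[OF nn less lt, of "int n"] enum_decomp[OF assms] that by simp
qed

subsection \<open>The word of highest differing indices\<close>

private abbreviation (input) w where "w \<equiv> w_word \<beta>"

text \<open>
  At the last integer before a multiple of \<open>P\<^sub>N\<close> the digit at the index \<open>N\<close> is the highest one to
  change; at all the other integers below \<open>P\<^bsub>N+1\<^esub>\<close> only lower digits change, as they do in the
  first copy of the integers below \<open>P\<^sub>N\<close>.
\<close>

lemma w_last:
  assumes "Suc k < cnt (Suc N)" "cnt N dvd Suc k"
  shows "w k = N"
  unfolding w_word_def
proof (rule Greatest_equality)
  have "Suc k div cnt N = Suc (k div cnt N)"
    using assms(2) by (simp add: div_Suc dvd_eq_mod_eq_0)
  then show "expansion \<beta> (xs k) (int N) \<noteq> expansion \<beta> (xs (Suc k)) (int N)"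
    using assms(1) by (simp add: expansion_enum_top)
  fix n assume "expansion \<beta> (xs k) (int n) \<noteq> expansion \<beta> (xs (Suc k)) (int n)"
  then show "n \<le> N"
    using expansion_enum_above[of k "Suc N" n] expansion_enum_above[of "Suc k" "Suc N" n] assms(1)
    by fastforce
qed

lemma w_cnt: "w (cnt N - 1) = N"
  by (rule w_last) (use cnt_pos[of N] cnt_less_Suc[of N] in auto)

lemma w_mod:
  assumes "Suc k < cnt (Suc N)"
  shows "w k = w (k mod cnt N)"
proof (cases "cnt N dvd Suc k")
  case True
  then have "Suc (k mod cnt N) = cnt N"
    by (metis dvd_eq_mod_eq_0 mod_Suc nat.distinct(1))
  then have "k mod cnt N = cnt N - 1" by simp
  then show ?thesis using w_last[OF assms True] w_cnt[of N] by simp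
next
  case False
  then have m: "Suc k mod cnt N = Suc (k mod cnt N)" "Suc k div cnt N = k div cnt N"
    by (auto simp: mod_Suc div_Suc dvd_eq_mod_eq_0 split: if_splits)
  have lt: "k mod cnt N < cnt N" "Suc (k mod cnt N) < cnt N"
    using cnt_pos[of N] m(1) mod_less_divisor[of "cnt N" "Suc k"] by simp_all
  have "(\<lambda>n::nat. expansion \<beta> (xs k) (int n) \<noteq> expansion \<beta> (xs (Suc k)) (int n)) =
    (\<lambda>n::nat. expansion \<beta> (xs (k mod cnt N)) (int n) \<noteq> expansion \<beta> (xs (Suc (k mod cnt N))) (int n))"
  proof
    fix n
    consider "n < N" | "n = N" | "n > N" by linarith
    then show "(expansion \<beta> (xs k) (int n) \<noteq> expansion \<beta> (xs (Suc k)) (int n)) =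
      (expansion \<beta> (xs (k mod cnt N)) (int n) \<noteq> expansion \<beta> (xs (Suc (k mod cnt N))) (int n))"
    proof cases
      case 1
      then show ?thesis
        using expansion_enum_below[of k N n] expansion_enum_below[of "Suc k" N n] assms m by simp
    next
      case 2
      then show ?thesis
        using assms m lt expansion_enum_above[of "k mod cnt N" N N]
        by (simp add: expansion_enum_top expansion_enum_above)
    next
      case 3
      then show ?thesis
        using assms lt by (simp add: expansion_enum_above[of _ N] expansion_enum_above[of _ "Suc N"])
    qed
  qed
  then show ?thesis by (simp add: w_word_def)
qed

section \<open>The block structure of the word\<close>

text \<open>
  The integers below \<open>R P\<^bsub>N+1\<^esub>\<close> consist of \<open>t\<close> copies of those below \<open>P\<^sub>N\<close>, where \<open>t\<close> is the quasi-greedy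
  digit for the remainder \<open>R\<close>, and of a copy of those below \<open>R' P\<^sub>N\<close>, where \<open>R'\<close> is the next
  remainder. The last letter, which belongs to the step to the first integer beyond the bound, is left out.
\<close>

lemma prefix_num_below_step:
  fixes R :: real and N :: nat
  defines "t \<equiv> \<lceil>\<beta> (int N) * R\<rceil> - 1"
  assumes R: "0 < R" "R \<le> 1"
  shows "prefix (num_below \<beta> (R * P (Suc N)) - 1) w =
    list_power (prefix (cnt N) w) t
      @ prefix (num_below \<beta> ((\<beta> (int N) * R - of_int t) * P N) - 1) w"
proof -
  define R' where "R' = \<beta> (int N) * R - of_int t"
  have "0 < R'" "R' \<le> 1" unfolding R'_def t_def by linarith+
  have pos: "P N > 0" by (rule base_prod_pos)
  have "\<beta> (int N) * R > 0" using alternate_base_pos[OF ab] R(1) by simp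
  then have t: "real (nat t) = of_int t" by (simp add: t_def)
  have eq: "R * P (Suc N) = real (nat t) * P N + R' * P N"
    unfolding t by (simp add: R'_def base_prod_Suc algebra_simps)
  have bounds: "0 < R' * P N" "R' * P N \<le> P N"
    using \<open>0 < R'\<close> \<open>R' \<le> 1\<close> pos by simp_all
  have le: "R * P (Suc N) \<le> P (Suc N)"
    using R base_prod_pos[of "Suc N"] by simp
  have cnt: "num_below \<beta> (R * P (Suc N)) = nat t * cnt N + num_below \<beta> (R' * P N)"
    unfolding eq by (rule num_below_add) (use bounds le eq in auto)
  have pos': "num_below \<beta> (R' * P N) > 0"
    using num_below_strict_mono[OF zero_B_integer bounds(1)] by simp
  have "prefix (num_below \<beta> (R * P (Suc N)) - 1) w =
    concat (replicate (nat t) (prefix (cnt N) w)) @ prefix (num_below \<beta> (R' * P N) - 1) w"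
  proof (rule prefix_if_mod)
    fix k assume "k < num_below \<beta> (R * P (Suc N)) - 1"
    then have "Suc k < num_below \<beta> (R * P (Suc N))" by simp
    also have "\<dots> \<le> cnt (Suc N)" by (rule num_below_mono[OF le])
    finally show "w k = w (k mod cnt N)" by (rule w_mod)
  next
    show "num_below \<beta> (R * P (Suc N)) - 1 = nat t * cnt N + (num_below \<beta> (R' * P N) - 1)"
      using cnt pos' by simp
    show "num_below \<beta> (R' * P N) - 1 \<le> cnt N"
      using num_below_mono[OF bounds(2)] by simp
  qed
  then show ?thesis by (simp add: list_power_def R'_def)
qed

lemma prefix_cnt_partial:
  fixes N :: nat
  defines "b \<equiv> shift_base (int N) \<beta>"
  assumes "j \<le> N"
  shows "prefix (cnt N - 1) w =
    concat (map (\<lambda>k. list_power (prefix (cnt (N - 1 - k)) w) (quasi_greedy b k)) [0..<j])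
      @ prefix (num_below \<beta> (qg_remainder b j * P (N - j)) - 1) w"
  using assms(2)
proof (induction j)
  case (Suc j)
  have ab': "alternate_base p b" unfolding b_def by (rule alternate_base_shift[OF ab])
  define M where "M = N - 1 - j"
  have M: "N - j = Suc M" "N - Suc j = M" using Suc.prems by (simp_all add: M_def)
  have base: "b (- 1 - int j) = \<beta> (int M)"
    using Suc.prems by (simp add: b_def shift_base_def M_def of_nat_diff algebra_simps)
  have digit: "quasi_greedy b j = \<lceil>\<beta> (int M) * qg_remainder b j\<rceil> - 1"
    using quasi_greedy_eq[OF ab', of j] base by simp
  have rem: "qg_remainder b (Suc j) = \<beta> (int M) * qg_remainder b j - of_int (quasi_greedy b j)"
    using qg_remainder_Suc[OF ab', of j] base by simp
  have "prefix (num_below \<beta> (qg_remainder b j * P (N - j)) - 1) w =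
      list_power (prefix (cnt M) w) (quasi_greedy b j)
        @ prefix (num_below \<beta> (qg_remainder b (Suc j) * P (N - Suc j)) - 1) w"
    unfolding M rem unfolding digit
    by (rule prefix_num_below_step) (use qg_remainder_bounds[of b j] in auto)
  then show ?case
    using Suc by (simp add: M_def del: qg_remainder.simps)
qed simp

text \<open>
  With \<open>t\<^sub>1 t\<^sub>2 \<cdots>\<close> for the quasi-greedy expansion that starts with the base \<open>\<beta>\<^bsub>N-1\<^esub>\<close>, the prefix \<open>U\<^sub>N\<close> of
  the word is \<open>U\<^bsub>N-1\<^esub>\<close> to the power \<open>t\<^sub>1\<close>, followed by \<open>U\<^bsub>N-2\<^esub>\<close> to the power \<open>t\<^sub>2\<close>, and so on down to
  \<open>U\<^sub>0\<close>, and then by the letter \<open>N\<close>.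
\<close>

lemma prefix_cnt:
  "prefix (cnt N) w =
    concat (map (\<lambda>k. list_power (prefix (cnt (N - 1 - k)) w)
                        (quasi_greedy (shift_base (int N) \<beta>) k)) [0..<N]) @ [N]"
proof -
  have "cnt N = Suc (cnt N - 1)" using cnt_pos[of N] by simp
  then have "prefix (cnt N) w = prefix (cnt N - 1) w @ [w (cnt N - 1)]"
    by (metis le0 subseq_to_Suc)
  moreover have "num_below \<beta> (qg_remainder (shift_base (int N) \<beta>) N * P (N - N)) = 1"
    using qg_remainder_bounds by (simp add: num_below_unit)
  ultimately show ?thesis
    using prefix_cnt_partial[of N N] w_cnt[of N] by simp
qed

lemma v_word_eq: "v_word p \<beta> = index_letter p \<beta> \<circ> w"
  by (simp add: fun_eq_iff v_word_def index_letter_def Let_def)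

lemma v_block_eq_map: "v_block p \<beta> N = map (index_letter p \<beta>) (prefix (cnt N) w)"
  by (simp add: v_block_def v_word_eq subsequence_def)

lemma v_block_prefix: "prefix (length (v_block p \<beta> N)) (v_word p \<beta>) = v_block p \<beta> N"
  by (simp add: v_block_def)

lemma length_v_block: "N \<le> length (v_block p \<beta> N)"
  using less_cnt[of N] by (simp add: v_block_def)

lemma v_block_0: "v_block p \<beta> 0 = [index_letter p \<beta> 0]"
  using prefix_cnt[of 0] by (simp add: v_block_eq_map num_below_1)

lemma v_block_decomp:
  "v_block p \<beta> N = concat (map (\<lambda>k. list_power (v_block p \<beta> (N - 1 - k))
      (quasi_greedy (shift_base (int N) \<beta>) k)) [0..<N]) @ [index_letter p \<beta> N]"
  by (subst v_block_eq_map, subst prefix_cnt)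
    (simp add: map_concat comp_def map_list_power v_block_eq_map)

lemma index_letter_in_range: "index_letter p \<beta> n \<in> range (v_word p \<beta>)"
proof -
  have "v_word p \<beta> (cnt n - 1) = index_letter p \<beta> n"
    using w_cnt[of n] by (simp add: v_word_eq)
  then show ?thesis by (metis rangeI)
qed

lemma range_v_word: "range (v_word p \<beta>) = range (index_letter p \<beta>)"
  using index_letter_in_range by (auto simp: v_word_eq)

end

section \<open>The blocks of a Parry alternate base\<close>

text \<open>
  The least preperiod and the least period, although minimised separately, work together.
\<close>

lemma common_periodic_params:
  assumes "parry p \<beta>"
  shows "common_periodic p \<beta> (preperiod_par p \<beta>) (period_par p \<beta>)"
proof -
  let ?q = "\<lambda>i. quasi_greedy (shift_base (int i) \<beta>)"
  have "\<forall>i\<in>{..<p}. \<exists>n q. periodic_from (?q i) n q"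
    using assms by (simp add: parry_def eventually_periodic_def)
  then obtain n q where nq: "\<And>i. i < p \<Longrightarrow> periodic_from (?q i) (n i) (q i)"
    by (metis lessThan_iff)
  define L where "L = (\<Sum>i<p. n i)"
  define Q where "Q = (\<Prod>i<p. q i)"
  have mult: "periodic_from x a (b * c)" if "periodic_from x a b" "c \<ge> 1" for x :: "int word" and a b c
  proof -
    have "x (k + b * j) = x k" if "k \<ge> a" for k j
    proof (induction j)
      case (Suc j)
      then show ?case
        using \<open>periodic_from x a b\<close> that unfolding periodic_from_def
        by (metis add.assoc add.commute mult_Suc_right trans_le_add1)
    qed simp
    then show ?thesis using that by (simp add: periodic_from_def)
  qed
  have weaken: "periodic_from x a' b" if "periodic_from x a b" "a \<le> a'" for x :: "int word" and a a' b
    using that by (simp add: periodic_from_def)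
  have "common_periodic p \<beta> L Q"
    unfolding common_periodic_def
  proof (intro conjI allI impI)
    have q1: "q i \<ge> 1" if "i < p" for i using nq[OF that] by (simp add: periodic_from_def)
    show Q1: "Q \<ge> 1" unfolding Q_def by (rule prod_ge_1) (use q1 in auto)
    fix i assume i: "i < p"
    have "n i \<le> L" unfolding L_def by (rule member_le_sum) (use i in auto)
    also have "L \<le> L * p" using i by simp
    finally have "periodic_from (?q i) (L * p) (q i)" by (rule weaken[OF nq[OF i]])
    moreover obtain c where "Q = q i * c"
      unfolding Q_def using i by (metis dvd_prodI dvdE finite_lessThan lessThan_iff)
    then have "Q * p = q i * (c * p)" "c * p \<ge> 1" using Q1 i by auto
    ultimately show "periodic_from (?q i) (L * p) (Q * p)" using mult by metis
  qed
  then have "\<exists>l m. common_periodic p \<beta> l m" by blast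
  then obtain m where m: "common_periodic p \<beta> (preperiod_par p \<beta>) m"
    unfolding preperiod_par_def by (rule LeastI2_ex[where Q = "\<lambda>l. \<exists>m. common_periodic p \<beta> l m", THEN exE]) auto
  have "\<exists>m l. common_periodic p \<beta> l m" using m by blast
  then obtain l where "common_periodic p \<beta> l (period_par p \<beta>)"
    unfolding period_par_def by (rule LeastI2_ex[where Q = "\<lambda>m. \<exists>l. common_periodic p \<beta> l m", THEN exE]) auto
  with m show ?thesis
    using periodic_from_change_preperiod unfolding common_periodic_def by blast
qed

lemma params_le:
  assumes "common_periodic p \<beta> l m"
  shows "preperiod_par p \<beta> \<le> l" "period_par p \<beta> \<le> m"
  using assms by (auto simp: preperiod_par_def period_par_def intro: Least_le)

lemma range_index_letter:
  assumes "p \<ge> 1" "period_par p \<beta> \<ge> 1"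
  shows "range (index_letter p \<beta>) = {..<preperiod_par p \<beta> * p + period_par p \<beta> * p}"
proof (intro equalityI subsetI)
  fix a assume "a \<in> range (index_letter p \<beta>)"
  then show "a \<in> {..<preperiod_par p \<beta> * p + period_par p \<beta> * p}"
    using assms by (auto simp: index_letter_def Let_def)
next
  fix a assume "a \<in> {..<preperiod_par p \<beta> * p + period_par p \<beta> * p}"
  then have "index_letter p \<beta> a = a"
    by (auto simp: index_letter_def Let_def)
  then show "a \<in> range (index_letter p \<beta>)" by (metis rangeI)
qed

text \<open>
  All letters below \<open>(\<ell> + m) p\<close> occur in \<open>v\<^sub>B\<close>. If it is sturmian, there are exactly two of them.
\<close>

lemma params_if_sturmian:
  assumes ab: "alternate_base p \<beta>" and parry: "parry p \<beta>" and st: "sturmian (v_word p \<beta>)"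
  shows "preperiod_par p \<beta> * p + period_par p \<beta> * p = 2"
proof -
  let ?n = "preperiod_par p \<beta> * p + period_par p \<beta> * p"
  have p: "p \<ge> 1" using ab by (simp add: alternate_base_def)
  have m: "period_par p \<beta> \<ge> 1"
    using common_periodic_params[OF parry] by (simp add: common_periodic_def)
  have range: "range (v_word p \<beta>) = {..<?n}"
    by (simp add: range_v_word[OF ab] range_index_letter[OF p m])
  obtain a b where "sturmian_over a b (v_word p \<beta>)" using st by (auto simp: sturmian_def)
  then have "{..<?n} \<subseteq> {a, b}" and np: "\<not> eventually_periodic (v_word p \<beta>)"
    using range by (auto simp: sturmian_over_def balanced_over_def)
  then have "card {..<?n} \<le> card {a, b}" by (intro card_mono) auto
  also have "card {a, b} \<le> 2" by (simp add: card_insert_if)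
  finally have "?n \<le> 2" by simp
  moreover have "?n \<noteq> 1"
  proof
    assume "?n = 1"
    then have "v_word p \<beta> k = 0" for k using range by (metis lessThan_iff less_one rangeI)
    then have "periodic_from (v_word p \<beta>) 0 1" by (simp add: periodic_from_def)
    then show False using np by (auto simp: eventually_periodic_def)
  qed
  moreover have "?n \<noteq> 0" using p m by simp
  ultimately show ?thesis by linarith
qed

lemma map_upt_Suc_shift: "map F [0..<Suc N] = F 0 # map (\<lambda>k. F (Suc k)) [0..<N]"
  by (simp add: upt_conv_Cons map_Suc_upt[symmetric] comp_def del: upt_Suc)

text \<open>
  For \<open>\<ell> p = 0\<close> and \<open>m p = 2\<close> the digits and letters of the levels \<open>N\<close> and \<open>N + 2\<close> agree, so
  that the blocks of level \<open>N + 2\<close> end with the block of level \<open>N\<close>. This covers \<open>p = 1\<close>, where both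
  quasi-greedy expansions coincide.
\<close>

lemma two_periodic_blocks_v_block:
  assumes ab: "alternate_base p \<beta>" and p: "p = 1 \<or> p = 2"
    and par: "preperiod_par p \<beta> = 0" "period_par p \<beta> * p = 2"
    and per: "common_periodic p \<beta> (preperiod_par p \<beta>) (period_par p \<beta>)"
  shows "two_periodic_blocks (quasi_greedy \<beta> 0) (quasi_greedy \<beta> 1)
    (quasi_greedy (shift_base 1 \<beta>) 0) (quasi_greedy (shift_base 1 \<beta>) 1) (v_block p \<beta>)"
proof -
  let ?q = "\<lambda>N. quasi_greedy (shift_base (int N) \<beta>)"
  let ?V = "v_block p \<beta>"
  have letter: "index_letter p \<beta> n = n mod 2" for n
    using par by (simp add: index_letter_def)
  have base_mod: "shift_base (int N) \<beta> = shift_base (int (N mod p)) \<beta>" for N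
    using shift_base_period[OF ab, of "N mod p" "N div p"] by (simp add: mult.commute)
  have even_odd: "shift_base (int N) \<beta> = (if even N then \<beta> else shift_base 1 \<beta>)" for N
  proof -
    have "shift_base 0 \<beta> = \<beta>" by (simp add: shift_base_def)
    moreover have "shift_base (int N) \<beta> = shift_base (int (N mod 2)) \<beta>"
      using p base_mod[of N] base_mod[of "N mod 2"] by auto
    ultimately show ?thesis by (auto simp: even_iff_mod_2_eq_zero odd_iff_mod_2_eq_one)
  qed
  have period: "?q N (k + 2) = ?q N k" for N k
  proof -
    have "periodic_from (?q (N mod p)) 0 2"
      using per par p by (auto simp: common_periodic_def)
    then show ?thesis using base_mod[of N] by (simp add: periodic_from_def)
  qed
  have step: "?V (N + 2) = list_power (?V (N + 1)) (?q N 0) @ list_power (?V N) (?q N 1) @ ?V N" for N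
  proof -
    have eq: "?q (N + 2) = ?q N" using even_odd[of N] even_odd[of "N + 2"] by simp
    have "?V (N + 2) = concat (map (\<lambda>k. list_power (?V (N + 1 - k)) (?q N k)) [0..<Suc (Suc N)])
        @ [index_letter p \<beta> N]"
      using v_block_decomp[OF ab, of "N + 2"] unfolding eq letter by simp
    also have "\<dots> = list_power (?V (N + 1)) (?q N 0) @ list_power (?V N) (?q N 1)
        @ concat (map (\<lambda>k. list_power (?V (N - 1 - k)) (?q N k)) [0..<N]) @ [index_letter p \<beta> N]"
      unfolding map_upt_Suc_shift using period[of N] by simp
    also have "\<dots> = list_power (?V (N + 1)) (?q N 0) @ list_power (?V N) (?q N 1) @ ?V N"
      using v_block_decomp[OF ab, of N] by simp
    finally show ?thesis .
  qed
  have V0: "?V 0 = [0]" using v_block_0[OF ab] by (simp add: letter)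
  have V1: "?V 1 = list_power [0] (?q 1 0) @ [1]"
    using v_block_decomp[OF ab, of 1] V0 by (simp add: letter)
  show ?thesis
    unfolding two_periodic_blocks_def using V0 V1 step even_odd by simp
qed

lemma preperiodic_blocks_v_block:
  assumes ab: "alternate_base 1 \<beta>"
    and par: "preperiod_par 1 \<beta> = 1" "period_par 1 \<beta> = 1"
    and per: "common_periodic 1 \<beta> 1 1"
  shows "\<exists>Y. preperiodic_blocks (quasi_greedy \<beta> 0) (quasi_greedy \<beta> 1) (v_block 1 \<beta>) Y"
proof -
  let ?V = "v_block 1 \<beta>" and ?q = "quasi_greedy \<beta>"
  define Y where "Y N = concat (map (\<lambda>k. list_power (?V (N - 1 - k)) (?q 1)) [0..<N]) @ [1]" for N
  have letter: "index_letter 1 \<beta> n = (if n = 0 then 0 else 1)" for n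
    using par by (simp add: index_letter_def)
  have base: "shift_base (int N) \<beta> = \<beta>" for N
    using shift_base_period[OF ab, of 0 N] by (simp add: shift_base_def)
  have digit: "?q (Suc k) = ?q 1" for k
  proof (induction k)
    case (Suc k)
    then show ?case using per base[of 0] by (simp add: common_periodic_def periodic_from_def)
  qed simp
  have "?V (Suc N) = list_power (?V N) (?q 0) @ Y N" for N
    using v_block_decomp[OF ab, of "Suc N"] letter[of "Suc N"]
    unfolding map_upt_Suc_shift base digit Y_def by simp
  moreover have "Y (Suc N) = list_power (?V N) (?q 1) @ Y N" for N
    unfolding Y_def map_upt_Suc_shift by simp
  moreover have "?V 0 = [0]" using v_block_0[OF ab] letter[of 0] by simp
  moreover have "Y 0 = [1]" by (simp add: Y_def)
  ultimately show ?thesis unfolding preperiodic_blocks_def by blast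
qed

section \<open>Roots of the quadratic polynomials\<close>

lemma is_the_positive_rootI:
  assumes "b * (b - d) = 1" "b > (0::real)"
  shows "is_the_positive_root [:- 1, - d, 1:] b"
  unfolding is_the_positive_root_def
proof (intro equalityI subsetI)
  fix y assume "y \<in> {y. y > 0 \<and> poly [:- 1, - d, 1:] y = 0}"
  then have y: "y > 0" "y * (y - d) = 1" by (auto simp: algebra_simps)
  then have "(y - b) * (y + b - d) = 0" using assms(1) by (simp add: algebra_simps)
  moreover have "b - d > 0" using assms by (metis zero_less_mult_pos zero_less_one)
  ultimately show "y \<in> {b}" using y(1) by simp
next
  fix y assume "y \<in> {b}"
  then show "y \<in> {y. y > 0 \<and> poly [:- 1, - d, 1:] y = 0}"
    using assms by (simp add: algebra_simps)
qed

lemma is_largest_root_reciprocal: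
  assumes "b\<^sup>2 + 1 = s * b" "b > (1::real)"
  shows "is_largest_root [:1, - s, 1:] b"
  unfolding is_largest_root_def
proof (intro conjI allI impI)
  show "poly [:1, - s, 1:] b = 0" using assms(1) by (simp add: algebra_simps power2_eq_square)
  fix y assume "poly [:1, - s, 1:] y = 0"
  then have y: "y\<^sup>2 + 1 = s * y" by (simp add: algebra_simps power2_eq_square)
  show "y \<le> b"
  proof (rule ccontr)
    assume less: "\<not> y \<le> b"
    have "(y - b) * (y + b - s) = 0"
      using assms(1) y by (simp add: algebra_simps power2_eq_square)
    \<comment> \<open>the other root is \<open>1 / b\<close>\<close>
    then have y_eq: "y = s - b" using less by simp
    have "b * y = s * b - b\<^sup>2" unfolding y_eq by (simp add: algebra_simps power2_eq_square)
    then have "b * y = 1" using assms(1) by simp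
    moreover have "b * y > 1 * 1" using less assms(2) by (intro mult_strict_mono) auto
    ultimately show False by simp
  qed
qed

lemma is_largest_root_two_periodic:
  fixes x y :: real
  assumes "x * (y - d) = 1" "y * (x - e) = 1" "x > 0" "y > 0" "d > 0"
  shows "is_largest_root [:- e, - (d * e), d:] x"
  unfolding is_largest_root_def
proof (intro conjI allI impI)
  have "d * x = y * x - 1" "e * y = y * x - 1" using assms(1,2) by (simp_all add: algebra_simps)
  then have eq: "d * x = e * y" by simp
  have "d * x * (x - e) = e * (y * (x - e))" unfolding eq by simp
  then have x0: "d * x * (x - e) = e" using assms(2) by simp
  then show "poly [:- e, - (d * e), d:] x = 0" by (simp add: algebra_simps)
  fix z assume "poly [:- e, - (d * e), d:] z = 0"
  then have z: "d * z * (z - e) = e" by (simp add: algebra_simps)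
  have "x - e > 0" using assms(2,4) by (metis zero_less_mult_pos zero_less_one)
  have "d * ((z - x) * (z + x - e)) = d * z * (z - e) - d * x * (x - e)"
    by (simp add: algebra_simps)
  then have "(z - x) * (z + x - e) = 0" using z x0 assms(5) by simp
  then show "z \<le> x" using \<open>x - e > 0\<close> assms(3) by auto
qed

section \<open>The sturmian cases\<close>

lemma shift_base_0 [simp]: "shift_base 0 \<beta> = \<beta>"
  by (simp add: shift_base_def)

lemma iter_two: "[x, y]\<^sup>\<omega> n = (if even n then x else y)"
  by (cases "even n")
    (simp_all add: numeral_2_eq_2[symmetric] even_iff_mod_2_eq_zero odd_iff_mod_2_eq_one)

lemma two_periodic_word: "periodic_from x 0 2 \<Longrightarrow> x = [x 0, x 1]\<^sup>\<omega>"
proof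
  fix n assume per: "periodic_from x 0 2"
  show "x n = [x 0, x 1]\<^sup>\<omega> n"
  proof (induction n rule: less_induct)
    case (less n)
    show ?case
    proof (cases "n < 2")
      case True
      then show ?thesis by (auto simp: less_2_cases_iff iter_two simp del: iter_nth)
    next
      case False
      then have n: "n = (n - 2) + 2" by simp
      then have "x n = x (n - 2)" using per unfolding periodic_from_def by (metis le0)
      then show ?thesis using less[of "n - 2"] False by (simp add: iter_two del: iter_nth)
    qed
  qed
qed

lemma preperiodic_word: "periodic_from x 1 1 \<Longrightarrow> x = [x 0] \<frown> [x 1]\<^sup>\<omega>"
proof
  fix n assume per: "periodic_from x 1 1"
  show "x n = ([x 0] \<frown> [x 1]\<^sup>\<omega>) n"
  proof (induction n)
    case (Suc n)
    then show ?case using per by (cases n) (auto simp: periodic_from_def)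
  qed simp
qed

text \<open>
  The quasi-greedy remainder returns to 1 after two steps.
\<close>

lemma two_periodic_base_relation:
  assumes ab: "alternate_base p \<beta>" and p: "p = 1 \<or> p = 2" and d: "quasi_greedy \<beta> = [d, 0]\<^sup>\<omega>"
  shows "\<beta> 0 * (\<beta> 1 - of_int d) = 1"
proof -
  have per: "\<beta> (n + 2) = \<beta> n" for n
    using p alternate_base_add_mult[OF ab, of n 1] alternate_base_add_mult[OF ab, of n 2] by auto
  have "qg_remainder \<beta> 2 = qg_remainder \<beta> 0"
  proof (rule qg_remainder_eq_if_digits_eq[OF ab])
    fix j
    show "\<beta> (- 1 - int (2 + j)) = \<beta> (- 1 - int (0 + j))"
      using per[of "- 1 - int (2 + j)"] by (simp add: algebra_simps)
    show "quasi_greedy \<beta> (2 + j) = quasi_greedy \<beta> (0 + j)"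
      unfolding d by (simp add: iter_two del: iter_nth)
  qed
  then have "\<beta> (- 2) * (\<beta> (- 1) - of_int d) = 1"
    using qg_remainder_Suc[OF ab, of 0] qg_remainder_Suc[OF ab, of 1] d
    by (simp add: numeral_2_eq_2 del: qg_remainder.simps(2))
  then show ?thesis using per[of "-2"] per[of "-1"] by simp
qed

lemma v_word_0: "two_periodic_blocks d e f g V \<Longrightarrow> prefix (length (V 0)) v = V 0 \<Longrightarrow> v 0 = 0"
  by (simp add: two_periodic_blocks_def)

lemma range_v_word_two_letters:
  assumes ab: "alternate_base p \<beta>" and "period_par p \<beta> \<ge> 1"
    and "preperiod_par p \<beta> * p + period_par p \<beta> * p = 2"
  shows "range (v_word p \<beta>) = {0, 1}"
proof -
  have p: "p \<ge> 1" using ab by (simp add: alternate_base_def)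
  show ?thesis
    unfolding range_v_word[OF ab] range_index_letter[OF p assms(2)] assms(3) by auto
qed

lemma two_periodic_params:
  assumes ab: "alternate_base p \<beta>" and parry: "parry p \<beta>"
    and q: "p = 1 \<and> quasi_greedy \<beta> = [d, 0]\<^sup>\<omega> \<and> d \<ge> 1 \<or>
      p = 2 \<and> quasi_greedy \<beta> = [d, 0]\<^sup>\<omega> \<and> quasi_greedy (shift_base 1 \<beta>) = [e, 0]\<^sup>\<omega>"
  shows "preperiod_par p \<beta> = 0" "period_par p \<beta> * p = 2"
proof -
  have m1: "period_par p \<beta> \<ge> 1"
    and cp: "common_periodic p \<beta> (preperiod_par p \<beta>) (period_par p \<beta>)"
    using common_periodic_params[OF parry] by (simp_all add: common_periodic_def)
  have per: "periodic_from [x, y]\<^sup>\<omega> 0 2" for x y :: int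
    by (simp add: periodic_from_def iter_two del: iter_nth)
  have "preperiod_par p \<beta> = 0 \<and> period_par p \<beta> * p = 2"
    using q
  proof
    assume q: "p = 1 \<and> quasi_greedy \<beta> = [d, 0]\<^sup>\<omega> \<and> d \<ge> 1"
    then have "common_periodic p \<beta> 0 2" using per by (simp add: common_periodic_def)
    from params_le[OF this] have le: "preperiod_par p \<beta> = 0" "period_par p \<beta> \<le> 2" by auto
    moreover have "period_par p \<beta> \<noteq> 1"
    proof
      assume "period_par p \<beta> = 1"
      then have "periodic_from (quasi_greedy \<beta>) 0 1"
        using cp le(1) conjunct1[OF q] by (simp add: common_periodic_def)
      then have "quasi_greedy \<beta> (0 + 1) = quasi_greedy \<beta> 0"
        unfolding periodic_from_def by blast
      then show False using q by simp
    qed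
    ultimately have "period_par p \<beta> = 2" using m1 by linarith
    then show ?thesis using le(1) q by simp
  next
    assume q: "p = 2 \<and> quasi_greedy \<beta> = [d, 0]\<^sup>\<omega> \<and> quasi_greedy (shift_base 1 \<beta>) = [e, 0]\<^sup>\<omega>"
    then have "common_periodic p \<beta> 0 1"
      using per by (auto simp: common_periodic_def less_2_cases_iff)
    from params_le[OF this] show ?thesis using m1 q by simp
  qed
  then show "preperiod_par p \<beta> = 0" "period_par p \<beta> * p = 2" by auto
qed

text \<open>
  The contraction \<open>\<gamma>\<close> of the substitution is \<open>1 / (\<beta>\<^sub>1 \<beta>\<^sub>0)\<close>. For \<open>p = 1\<close> the two expansions are the same
  and \<open>d = e\<close>.
\<close>

lemma two_periodic_sturmian:
  assumes ab: "alternate_base p \<beta>" and parry: "parry p \<beta>" and p: "p = 1 \<or> p = 2"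
    and par: "preperiod_par p \<beta> = 0" "period_par p \<beta> * p = 2"
    and d: "d \<ge> 1" "quasi_greedy \<beta> = [d, 0]\<^sup>\<omega>"
    and e: "e \<ge> 1" "quasi_greedy (shift_base 1 \<beta>) = [e, 0]\<^sup>\<omega>"
  shows "two_periodic_blocks d 0 e 0 (v_block p \<beta>)"
    and "\<beta> 0 * (\<beta> 1 - of_int d) = 1" "\<beta> 1 * (\<beta> 0 - of_int e) = 1"
    and "(\<beta> 1 * \<beta> 0)\<^sup>2 + 1 = of_int (d * e + 2) * (\<beta> 1 * \<beta> 0)"
    and "fixed_by_subst (subst01 (list_power (list_power [0] e @ [1]) d @ [0])
           (list_power [0] e @ [1])) (v_word p \<beta>)"
    and "sturmian_over 0 1 (v_word p \<beta>)"
proof -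
  show blocks: "two_periodic_blocks d 0 e 0 (v_block p \<beta>)"
    using two_periodic_blocks_v_block[OF ab p par common_periodic_params[OF parry]] d(2) e(2)
    by simp
  show rel0: "\<beta> 0 * (\<beta> 1 - of_int d) = 1"
    by (rule two_periodic_base_relation[OF ab p d(2)])
  have "\<beta> 2 = \<beta> 0"
    using p alternate_base_add_mult[OF ab, of 0 1] alternate_base_add_mult[OF ab, of 0 2] by auto
  then show rel1: "\<beta> 1 * (\<beta> 0 - of_int e) = 1"
    using two_periodic_base_relation[OF alternate_base_shift[OF ab, of 1] p e(2)]
    by (simp add: shift_base_def)
  define Q where "Q = \<beta> 1 * \<beta> 0"
  have "of_int d * \<beta> 0 = Q - 1" "of_int e * \<beta> 1 = Q - 1"
    using rel0 rel1 by (simp_all add: Q_def algebra_simps)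
  then have "(Q - 1) * (Q - 1) = (of_int d * \<beta> 0) * (of_int e * \<beta> 1)" by simp
  also have "\<dots> = of_int (d * e) * Q" by (simp add: Q_def)
  finally have Q: "Q\<^sup>2 + 1 = of_int (d * e + 2) * Q"
    by (simp add: algebra_simps power2_eq_square)
  then show "(\<beta> 1 * \<beta> 0)\<^sup>2 + 1 = of_int (d * e + 2) * (\<beta> 1 * \<beta> 0)" by (simp add: Q_def)
  have Q1: "Q > 1"
    unfolding Q_def using alternate_base_gt1[OF ab] by (simp add: less_1_mult)
  have \<gamma>: "0 < 1 / Q" "1 / Q < 1" "(1 / Q)\<^sup>2 + 1 = of_int (d * e + 2) * (1 / Q)"
  proof -
    show "0 < 1 / Q" "1 / Q < 1" using Q1 by simp_all
    have "(1 / Q)\<^sup>2 + 1 = (Q\<^sup>2 + 1) / Q\<^sup>2" using Q1 by (simp add: power_divide add_divide_distrib)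
    also have "\<dots> = of_int (d * e + 2) * (1 / Q)"
      unfolding Q using Q1 by (simp add: power2_eq_square)
    finally show "(1 / Q)\<^sup>2 + 1 = of_int (d * e + 2) * (1 / Q)" .
  qed
  show fixed: "fixed_by_subst (subst01 (list_power (list_power [0] e @ [1]) d @ [0])
      (list_power [0] e @ [1])) (v_word p \<beta>)"
    by (rule two_periodic_blocks_fixed[OF blocks d(1) e(1) v_block_prefix[OF ab] length_v_block[OF ab]])
  have "range (v_word p \<beta>) \<subseteq> {0, 1}"
    using range_v_word_two_letters[OF ab] par p by (cases "period_par p \<beta>") auto
  moreover have "v_word p \<beta> 0 = 0"
    by (rule v_word_0[OF blocks v_block_prefix[OF ab]])
  ultimately show "sturmian_over 0 1 (v_word p \<beta>)"
    using sturmian_fixed_word_blocks[OF d(1) e(1) \<gamma> _ fixed] by blast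
qed

lemma sturmian_if_one_digit_and_zero:
  assumes ab: "alternate_base p \<beta>" and parry: "parry p \<beta>"
    and d: "d \<ge> 1" "p = 1" "quasi_greedy \<beta> = [d, 0]\<^sup>\<omega>"
  shows "sturmian (v_word p \<beta>)"
    and "is_the_positive_root [:- 1, - of_int d, 1:] (\<beta> 0)"
    and "is_the_sturmian_fixed_by (v_word p \<beta>) (subst01 (list_power [0] d @ [1]) [0])"
proof -
  have per: "\<beta> 1 = \<beta> 0" using alternate_base_add_mult[OF ab, of 0 1] d(2) by simp
  have shift: "shift_base 1 \<beta> = \<beta>" using shift_base_period[OF ab, of 0 1] d(2) by simp
  have par: "preperiod_par p \<beta> = 0" "period_par p \<beta> * p = 2"
    using two_periodic_params[OF ab parry, of d 0] d by auto
  note facts = two_periodic_sturmian[OF ab parry disjI1[OF d(2)] par d(1,3) d(1), unfolded shift, OF d(3)]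
  show "sturmian (v_word p \<beta>)" using facts(6) by (auto simp: sturmian_def)
  show "is_the_positive_root [:- 1, - of_int d, 1:] (\<beta> 0)"
    by (rule is_the_positive_rootI) (use facts(2) per alternate_base_pos[OF ab] in simp_all)
  have "fixed_by_subst (subst01 (list_power [0] d @ [1]) [0]) (v_word p \<beta>)"
    by (rule two_periodic_blocks_fixed_equal[OF facts(1) v_block_prefix[OF ab] length_v_block[OF ab]])
  then show "is_the_sturmian_fixed_by (v_word p \<beta>) (subst01 (list_power [0] d @ [1]) [0])"
    using d(1) facts(6)
    by (intro is_the_sturmian_fixed_byI) (auto simp: list_power_Cons length_list_power)
qed

lemma sturmian_if_two_digits_and_zeros:
  assumes ab: "alternate_base p \<beta>" and parry: "parry p \<beta>" and p: "p = 2"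
    and d: "d \<ge> 1" "quasi_greedy \<beta> = [d, 0]\<^sup>\<omega>"
    and e: "e \<ge> 1" "quasi_greedy (shift_base 1 \<beta>) = [e, 0]\<^sup>\<omega>"
  shows "sturmian (v_word p \<beta>)"
    and "is_largest_root [:- of_int e, - of_int (d * e), of_int d:] (\<beta> 0)"
    and "is_largest_root [:- of_int d, - of_int (d * e), of_int e:] (\<beta> 1)"
    and "is_largest_root [:1, - of_int (d * e + 2), 1:] (\<beta> 1 * \<beta> 0)"
    and "is_the_sturmian_fixed_by (v_word p \<beta>)
      (subst01 (list_power (list_power [0] e @ [1]) d @ [0]) (list_power [0] e @ [1]))"
proof -
  have par: "preperiod_par p \<beta> = 0" "period_par p \<beta> * p = 2"
    using two_periodic_params[OF ab parry, of d e] p d e by auto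
  note facts = two_periodic_sturmian[OF ab parry disjI2[OF p] par d e]
  have pos: "\<beta> 0 > 0" "\<beta> 1 > 0" by (simp_all add: alternate_base_pos[OF ab])
  show "sturmian (v_word p \<beta>)" using facts(6) by (auto simp: sturmian_def)
  show "is_largest_root [:- of_int e, - of_int (d * e), of_int d:] (\<beta> 0)"
    using is_largest_root_two_periodic[OF facts(2,3) pos] d(1) by simp
  show "is_largest_root [:- of_int d, - of_int (d * e), of_int e:] (\<beta> 1)"
    using is_largest_root_two_periodic[OF facts(3,2) pos(2,1)] e(1) by (simp add: mult.commute)
  show "is_largest_root [:1, - of_int (d * e + 2), 1:] (\<beta> 1 * \<beta> 0)"
    by (rule is_largest_root_reciprocal[OF facts(4)])
      (use alternate_base_gt1[OF ab] in \<open>simp add: less_1_mult\<close>)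
  have "list_power [0::nat] e \<noteq> []" "hd (list_power [0::nat] e) = 0"
    using e(1) by (simp_all add: list_power_Cons)
  moreover have "list_power (list_power [0::nat] e @ [1]) d @ [0]
      = (list_power [0] e @ [1]) @ list_power (list_power [0] e @ [1]) (d - 1) @ [0]"
    using d(1) by (simp add: list_power_Cons)
  ultimately show "is_the_sturmian_fixed_by (v_word p \<beta>)
      (subst01 (list_power (list_power [0] e @ [1]) d @ [0]) (list_power [0] e @ [1]))"
    using facts(5,6) by (intro is_the_sturmian_fixed_byI) (simp_all add: hd_append)
qed

lemma sturmian_if_digits_differ_by_one:
  assumes ab: "alternate_base p \<beta>" and parry: "parry p \<beta>"
    and d: "d \<ge> 1" "p = 1" "quasi_greedy \<beta> = [d + 1] \<frown> [d]\<^sup>\<omega>"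
  shows "sturmian (v_word p \<beta>)"
    and "is_largest_root [:1, - of_int (d + 2), 1:] (\<beta> 0)"
    and "is_the_sturmian_fixed_by (v_word p \<beta>)
      (subst01 (list_power [0] (d + 1) @ [1]) (list_power [0] d @ [1]))"
proof -
  note p = d(2)
  have per: "\<beta> n = \<beta> 0" for n
  proof -
    have step: "\<beta> (n + int k) = \<beta> n" for n k
      using alternate_base_add_mult[OF ab, of n k] p by simp
    show ?thesis using step[of n "nat (- n)"] step[of 0 "nat n"] by (cases "n \<ge> 0") auto
  qed
  have q0: "quasi_greedy \<beta> 0 = d + 1" and qS: "quasi_greedy \<beta> (Suc k) = d" for k
    unfolding d(3) by simp_all
  have cp: "common_periodic p \<beta> (preperiod_par p \<beta>) (period_par p \<beta>)"
    by (rule common_periodic_params[OF parry])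
  have m1: "period_par p \<beta> \<ge> 1" using cp by (simp add: common_periodic_def)
  have cp11: "common_periodic p \<beta> 1 1"
    unfolding common_periodic_def p periodic_from_def using qS by (auto simp: gr0_conv_Suc Suc_le_eq)
  have "preperiod_par p \<beta> \<noteq> 0"
  proof
    assume "preperiod_par p \<beta> = 0"
    then have "quasi_greedy \<beta> (period_par p \<beta>) = quasi_greedy \<beta> 0"
      using cp p unfolding common_periodic_def periodic_from_def
      by (metis add_0 le0 mult.right_neutral mult_0 of_nat_0 shift_base_0 zero_less_one)
    then show False using q0 qS[of "period_par p \<beta> - 1"] m1 by simp
  qed
  then have par: "preperiod_par p \<beta> = 1" "period_par p \<beta> = 1"
    using params_le[OF cp11] m1 by simp_all
  have q1: "quasi_greedy \<beta> 1 = d" using qS[of 0] by simp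
  have "\<exists>Y. preperiodic_blocks (d + 1) d (v_block p \<beta>) Y"
    using preperiodic_blocks_v_block[of \<beta>] ab par cp11 q0 q1 unfolding p by metis
  then obtain Y where blocks: "preperiodic_blocks (d + 1) d (v_block p \<beta>) Y" by blast
  have "qg_remainder \<beta> 2 = qg_remainder \<beta> 1"
  proof (rule qg_remainder_eq_if_digits_eq[OF ab])
    fix j
    show "\<beta> (- 1 - int (2 + j)) = \<beta> (- 1 - int (1 + j))" using per by metis
    show "quasi_greedy \<beta> (2 + j) = quasi_greedy \<beta> (1 + j)" using qS by simp
  qed
  then have "\<beta> 0 * (\<beta> 0 - of_int (d + 1)) - of_int d = \<beta> 0 - of_int (d + 1)"
    using qg_remainder_Suc[OF ab, of 0] qg_remainder_Suc[OF ab, of 1] q0 q1 per[of "-1"] per[of "-2"]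
    by (simp add: numeral_2_eq_2 del: qg_remainder.simps(2))
  then have b: "(\<beta> 0)\<^sup>2 + 1 = of_int (d + 2) * \<beta> 0"
    by (simp add: algebra_simps power2_eq_square)
  have b1: "\<beta> 0 > 1" by (rule alternate_base_gt1[OF ab])
  show "is_largest_root [:1, - of_int (d + 2), 1:] (\<beta> 0)"
    by (rule is_largest_root_reciprocal[OF b b1])
  have \<gamma>: "0 < 1 / \<beta> 0" "1 / \<beta> 0 < 1" "(1 / \<beta> 0)\<^sup>2 + 1 = of_int (d + 2) * (1 / \<beta> 0)"
  proof -
    show "0 < 1 / \<beta> 0" "1 / \<beta> 0 < 1" using b1 by simp_all
    have "(1 / \<beta> 0)\<^sup>2 + 1 = ((\<beta> 0)\<^sup>2 + 1) / (\<beta> 0)\<^sup>2"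
      using b1 by (simp add: power_divide add_divide_distrib)
    also have "\<dots> = of_int (d + 2) * (1 / \<beta> 0)"
      unfolding b using b1 by (simp add: power2_eq_square)
    finally show "(1 / \<beta> 0)\<^sup>2 + 1 = of_int (d + 2) * (1 / \<beta> 0)" .
  qed
  have fixed: "fixed_by_subst (subst01 (list_power [0] (d + 1) @ [1]) (list_power [0] d @ [1])) (v_word p \<beta>)"
    by (rule preperiodic_blocks_fixed[OF blocks v_block_prefix[OF ab] length_v_block[OF ab]])
  have "range (v_word p \<beta>) \<subseteq> {0, 1}"
    using range_v_word_two_letters[OF ab m1] par p by simp
  moreover have "v_word p \<beta> 0 = 0"
    using v_block_prefix[OF ab, of 0] blocks by (simp add: preperiodic_blocks_def)
  ultimately have st: "sturmian_over 0 1 (v_word p \<beta>)"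
    using sturmian_fixed_word_zeros_one[OF d(1) \<gamma> _ fixed] by blast
  then show "sturmian (v_word p \<beta>)" by (auto simp: sturmian_def)
  show "is_the_sturmian_fixed_by (v_word p \<beta>)
      (subst01 (list_power [0] (d + 1) @ [1]) (list_power [0] d @ [1]))"
    using d(1) st fixed
    by (intro is_the_sturmian_fixed_byI) (auto simp: list_power_Cons length_list_power)
qed

section \<open>Only these cases are sturmian\<close>

lemma quasi_greedy_le_first:
  assumes "alternate_base 1 \<beta>"
  shows "quasi_greedy \<beta> 1 \<le> quasi_greedy \<beta> 0"
proof -
  have "\<beta> (- 2) = \<beta> (- 1)" using alternate_base_add_mult[OF assms, of "-2" 1] by simp
  moreover have "\<beta> (- 1) * qg_remainder \<beta> 1 \<le> \<beta> (- 1) * 1"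
    using qg_remainder_bounds[of \<beta> 1] alternate_base_pos[OF assms] by (intro mult_left_mono) (auto intro: less_imp_le)
  ultimately have "\<lceil>\<beta> (- 2) * qg_remainder \<beta> 1\<rceil> \<le> \<lceil>\<beta> (- 1) * qg_remainder \<beta> 0\<rceil>"
    by (intro ceiling_mono) simp
  then show ?thesis
    unfolding quasi_greedy_eq[OF assms] by (simp del: qg_remainder.simps(2))
qed

lemma two_periodic_if_sturmian:
  assumes ab: "alternate_base p \<beta>" and parry: "parry p \<beta>" and p: "p = 1 \<or> p = 2"
    and par: "preperiod_par p \<beta> = 0" "period_par p \<beta> * p = 2"
    and st: "sturmian_over 0 1 (v_word p \<beta>)"
  shows "quasi_greedy \<beta> = [quasi_greedy \<beta> 0, 0]\<^sup>\<omega>"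
    and "p = 2 \<Longrightarrow> quasi_greedy (shift_base 1 \<beta>) = [quasi_greedy (shift_base 1 \<beta>) 0, 0]\<^sup>\<omega>"
proof -
  note ab' = alternate_base_shift[OF ab, of 1]
  note cp = common_periodic_params[OF parry]
  have zero: "quasi_greedy \<beta> 1 = 0 \<and> quasi_greedy (shift_base 1 \<beta>) 1 = 0"
    by (rule second_digit_zero_if_balanced[OF two_periodic_blocks_v_block[OF ab p par cp]])
      (use st quasi_greedy_first_ge_1[OF ab] quasi_greedy_first_ge_1[OF ab'] quasi_greedy_nonneg[OF ab]
        quasi_greedy_nonneg[OF ab'] v_block_prefix[OF ab] in \<open>auto simp: sturmian_over_def\<close>)
  have per: "periodic_from (quasi_greedy (shift_base (int i) \<beta>)) 0 2" if "i < p" for i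
    using cp that par by (auto simp: common_periodic_def)
  show "quasi_greedy \<beta> = [quasi_greedy \<beta> 0, 0]\<^sup>\<omega>"
    using two_periodic_word[OF per[of 0]] zero p by auto
  show "quasi_greedy (shift_base 1 \<beta>) = [quasi_greedy (shift_base 1 \<beta>) 0, 0]\<^sup>\<omega>" if "p = 2"
    using two_periodic_word[OF per[of 1]] zero that by simp
qed

text \<open>
  Balance bounds the first digit from above. It differs from the others, as the preperiod 0 is excluded,
  and these are not 0, as a positive remainder cannot stay the same when it is multiplied by the base.
\<close>

lemma preperiodic_if_sturmian:
  assumes ab: "alternate_base 1 \<beta>" and parry: "parry 1 \<beta>"
    and par: "preperiod_par 1 \<beta> = 1" "period_par 1 \<beta> = 1"
    and st: "sturmian_over 0 1 (v_word 1 \<beta>)"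
  shows "quasi_greedy \<beta> 1 \<ge> 1" "quasi_greedy \<beta> = [quasi_greedy \<beta> 1 + 1] \<frown> [quasi_greedy \<beta> 1]\<^sup>\<omega>"
proof -
  let ?q = "quasi_greedy \<beta>"
  have cp: "common_periodic 1 \<beta> 1 1" using common_periodic_params[OF parry] par by simp
  then have per: "periodic_from ?q 1 1" by (simp add: common_periodic_def)
  obtain Y where blocks: "preperiodic_blocks (?q 0) (?q 1) (v_block 1 \<beta>) Y"
    using preperiodic_blocks_v_block[OF ab par cp] by blast
  have "?q 0 \<le> ?q 1 + 1"
    by (rule first_digit_le_if_balanced[OF blocks quasi_greedy_first_ge_1[OF ab] quasi_greedy_nonneg[OF ab]
          v_block_prefix[OF ab]]) (use st in \<open>simp add: sturmian_over_def\<close>)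
  moreover have "?q 0 \<noteq> ?q 1"
  proof
    assume eq: "?q 0 = ?q 1"
    have "?q (k + 1) = ?q k" for k
      using per eq by (cases k) (auto simp: periodic_from_def)
    then have "common_periodic 1 \<beta> 0 1" by (simp add: common_periodic_def periodic_from_def)
    then show False using params_le(1) par by fastforce
  qed
  ultimately have q0: "?q 0 = ?q 1 + 1" using quasi_greedy_le_first[OF ab] by linarith
  then show "?q = [?q 1 + 1] \<frown> [?q 1]\<^sup>\<omega>" using preperiodic_word[OF per] by simp
  show "?q 1 \<ge> 1"
  proof (rule ccontr)
    assume "\<not> ?q 1 \<ge> 1"
    then have q1: "?q 1 = 0" using quasi_greedy_nonneg[OF ab, of 1] by linarith
    have "qg_remainder \<beta> 2 = qg_remainder \<beta> 1"
    proof (rule qg_remainder_eq_if_digits_eq[OF ab])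
      fix j
      show "\<beta> (- 1 - int (2 + j)) = \<beta> (- 1 - int (1 + j))"
        using alternate_base_add_mult[OF ab, of "- 1 - int (2 + j)" 1] by (simp add: algebra_simps)
      show "?q (2 + j) = ?q (1 + j)" using per by (simp add: periodic_from_def)
    qed
    then have "\<beta> (- 2) * qg_remainder \<beta> 1 = qg_remainder \<beta> 1"
      using qg_remainder_Suc[OF ab, of 1] q1
      by (simp add: numeral_2_eq_2 del: qg_remainder.simps(2))
    moreover have "qg_remainder \<beta> 1 > 0" using qg_remainder_bounds by blast
    ultimately show False using alternate_base_gt1[OF ab, of "-2"] by simp
  qed
qed

lemma mult_add_eq_2:
  fixes l m p :: nat
  assumes "l * p + m * p = 2" "m \<ge> 1"
  shows "(p = 1 \<and> l = 0 \<and> m = 2) \<or> (p = 1 \<and> l = 1 \<and> m = 1) \<or> (p = 2 \<and> l = 0 \<and> m = 1)"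
proof -
  have "(l + m) * p = 2" using assms(1) by (simp add: algebra_simps)
  moreover from this have "p dvd 2" by (metis dvd_triv_right)
  moreover have "p \<noteq> 0" using assms(1) by (intro notI) simp
  ultimately have "p \<le> 2" "p \<noteq> 0" by (auto dest: dvd_imp_le)
  then have "p = 1 \<or> p = 2" by linarith
  then show ?thesis using \<open>(l + m) * p = 2\<close> assms(2) by auto
qed

lemma sturmian_cases:
  assumes ab: "alternate_base p \<beta>" and parry: "parry p \<beta>" and st: "sturmian (v_word p \<beta>)"
  shows "(\<exists>d::int. d \<ge> 1 \<and> p = 1 \<and> quasi_greedy \<beta> = [d, 0]\<^sup>\<omega>)
      \<or> (\<exists>d::int. d \<ge> 1 \<and> p = 1 \<and> quasi_greedy \<beta> = [d + 1] \<frown> [d]\<^sup>\<omega>)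
      \<or> (\<exists>d e::int. d \<ge> 1 \<and> e \<ge> 1 \<and> p = 2 \<and> quasi_greedy \<beta> = [d, 0]\<^sup>\<omega>
            \<and> quasi_greedy (shift_base 1 \<beta>) = [e, 0]\<^sup>\<omega>)"
proof -
  let ?l = "preperiod_par p \<beta>" and ?m = "period_par p \<beta>"
  have sum: "?l * p + ?m * p = 2" by (rule params_if_sturmian[OF ab parry st])
  have m: "?m \<ge> 1" using common_periodic_params[OF parry] by (simp add: common_periodic_def)
  have "range (v_word p \<beta>) = {0, 1}" by (rule range_v_word_two_letters[OF ab m sum])
  then have st01: "sturmian_over 0 1 (v_word p \<beta>)" by (intro sturmian_overI[OF st]) auto
  have d1: "quasi_greedy \<beta> 0 \<ge> 1" by (rule quasi_greedy_first_ge_1[OF ab])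
  from mult_add_eq_2[OF sum m] show ?thesis
  proof (elim disjE conjE)
    assume 1: "p = 1" "?l = 0" "?m = 2"
    then have "quasi_greedy \<beta> = [quasi_greedy \<beta> 0, 0]\<^sup>\<omega>"
      using two_periodic_if_sturmian(1)[OF ab parry _ _ _ st01] by simp
    then show ?thesis using d1 1 by blast
  next
    assume "p = 1" "?l = 1" "?m = 1"
    then show ?thesis using preperiodic_if_sturmian[of \<beta>] ab parry st01 by blast
  next
    assume 3: "p = 2" "?l = 0" "?m = 1"
    then have "quasi_greedy \<beta> = [quasi_greedy \<beta> 0, 0]\<^sup>\<omega>"
      "quasi_greedy (shift_base 1 \<beta>) = [quasi_greedy (shift_base 1 \<beta>) 0, 0]\<^sup>\<omega>"
      using two_periodic_if_sturmian[OF ab parry _ _ _ st01] by simp_all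
    moreover have "quasi_greedy (shift_base 1 \<beta>) 0 \<ge> 1"
      by (rule quasi_greedy_first_ge_1[OF alternate_base_shift[OF ab]])
    ultimately show ?thesis using d1 3 by blast
  qed
qed

theorem proposition25:
  fixes p :: nat and \<beta> :: "int \<Rightarrow> real"
  assumes "alternate_base p \<beta>" and "parry p \<beta>"
  shows
    "(sturmian (v_word p \<beta>) \<longleftrightarrow>
        (\<exists>d::int. d \<ge> 1 \<and> p = 1 \<and> quasi_greedy \<beta> = [d, 0]\<^sup>\<omega>)
      \<or> (\<exists>d::int. d \<ge> 1 \<and> p = 1 \<and> quasi_greedy \<beta> = [d + 1] \<frown> [d]\<^sup>\<omega>)
      \<or> (\<exists>d e::int. d \<ge> 1 \<and> e \<ge> 1 \<and> p = 2 \<and> quasi_greedy \<beta> = [d, 0]\<^sup>\<omega>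
            \<and> quasi_greedy (shift_base 1 \<beta>) = [e, 0]\<^sup>\<omega>))
   \<and> (\<forall>d::int. d \<ge> 1 \<and> p = 1 \<and> quasi_greedy \<beta> = [d, 0]\<^sup>\<omega> \<longrightarrow>
        is_the_positive_root [:- 1, - of_int d, 1:] (\<beta> 0)
      \<and> is_the_sturmian_fixed_by (v_word p \<beta>)
          (subst01 (list_power [0] d @ [1]) [0]))
   \<and> (\<forall>d::int. d \<ge> 1 \<and> p = 1 \<and> quasi_greedy \<beta> = [d + 1] \<frown> [d]\<^sup>\<omega> \<longrightarrow>
        is_largest_root [:1, - of_int (d + 2), 1:] (\<beta> 0)
      \<and> is_the_sturmian_fixed_by (v_word p \<beta>)
          (subst01 (list_power [0] (d + 1) @ [1]) (list_power [0] d @ [1])))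
   \<and> (\<forall>d e::int. d \<ge> 1 \<and> e \<ge> 1 \<and> p = 2 \<and> quasi_greedy \<beta> = [d, 0]\<^sup>\<omega>
            \<and> quasi_greedy (shift_base 1 \<beta>) = [e, 0]\<^sup>\<omega> \<longrightarrow>
        is_largest_root [:- of_int e, - of_int (d * e), of_int d:] (\<beta> 0)
      \<and> is_largest_root [:- of_int d, - of_int (d * e), of_int e:] (\<beta> 1)
      \<and> is_largest_root [:1, - of_int (d * e + 2), 1:] (\<beta> 1 * \<beta> 0)
      \<and> is_the_sturmian_fixed_by (v_word p \<beta>)
          (subst01 (list_power (list_power [0] e @ [1]) d @ [0]) (list_power [0] e @ [1])))"
proof (intro conjI)
  let ?cases = "(\<exists>d::int. d \<ge> 1 \<and> p = 1 \<and> quasi_greedy \<beta> = [d, 0]\<^sup>\<omega>)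
      \<or> (\<exists>d::int. d \<ge> 1 \<and> p = 1 \<and> quasi_greedy \<beta> = [d + 1] \<frown> [d]\<^sup>\<omega>)
      \<or> (\<exists>d e::int. d \<ge> 1 \<and> e \<ge> 1 \<and> p = 2 \<and> quasi_greedy \<beta> = [d, 0]\<^sup>\<omega>
            \<and> quasi_greedy (shift_base 1 \<beta>) = [e, 0]\<^sup>\<omega>)"
  show "sturmian (v_word p \<beta>) \<longleftrightarrow> ?cases"
  proof
    assume "sturmian (v_word p \<beta>)"
    then show ?cases by (rule sturmian_cases[OF assms])
  next
    assume ?cases
    then show "sturmian (v_word p \<beta>)"
      by (elim disjE exE conjE)
        (rule sturmian_if_one_digit_and_zero(1)[OF assms] sturmian_if_digits_differ_by_one(1)[OF assms] sturmian_if_two_digits_and_zeros(1)[OF assms]; assumption)+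
  qed
qed (use sturmian_if_one_digit_and_zero(2,3)[OF assms] sturmian_if_digits_differ_by_one(2,3)[OF assms] sturmian_if_two_digits_and_zeros(2-5)[OF assms] in simp_all)

end
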